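(* Let $\mathcal{L}$ be a complete lattice, let $\mathcal{Q}$ be a poset equipped with a superlinear family of translations $T_\bullet$, let $f\colon\mathcal{L}\to\mathcal{Q}$ be a $\delta$-approximation that respects joins, and let $\mathbf{C}$ be a cocomplete category. Then the pullback functor $f^*\colon\mathrm{Fun}(\mathcal{Q},\mathbf{C})\to\mathrm{Fun}(\mathcal{L},\mathbf{C})$ has distortion at most $2\delta$: for every pair of $\mathcal{Q}$-modules $M,N$, $$|d_{\mathcal{Q}}(M,N)-d_{\mathcal{L}}(f^*M,f^*N)|\le2\delta,$$ where $d_{\mathcal{Q}}$ is the weak interleaving distance over $\mathcal{Q}$ and $d_{\mathcal{L}}=d_f$ is the weak relative interleaving distance over $\mathcal{L}$ with respect to $f$.
   Context: Posets are viewed as categories; a map of posets is a monotone map. For a poset $\mathcal{P}$ and a category $\mathbf{C}$, a $\mathcal{P}$-module is a functor $\mathcal{P}\to\mathbf{C}$. Pullback and pushforward: for a map of posets $f\colon\mathcal{P}\to\mathcal{Q}$, $f^*M=M\circ f$, and $f_*M=\mathrm{Lan}_fM$, i.e. $(f_*M)(q)=\varinjlim_{p\,:\,f(p)\le q}M(p)$. The functor $f_*$ is left adjoint to $f^*$, with unit $\upsilon\colon\mathrm{id}\Rightarrow f^*f_*$ and counit $\chi\colon f_*f^*\Rightarrow\mathrm{id}$. Translations: a translation on $\mathcal{Q}$ is a monotone map $T\colon\mathcal{Q}\to\mathcal{Q}$ with $q\le T(q)$ for all $q$. A superlinear family of translations is an assignment $\varepsilon\mapsto T_\varepsilon$, $\varepsilon\in[0,\infty)$,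 of translations with $T_{\varepsilon_2}\circ T_{\varepsilon_1}\le T_{\varepsilon_1+\varepsilon_2}$ pointwise (hence $T_\varepsilon\le T_{\varepsilon'}$ when $\varepsilon\le\varepsilon'$). $\delta$-approximation: $f\colon\mathcal{P}\to\mathcal{Q}$ is a $\delta$-approximation if for every $q\in\mathcal{Q}$ there is $p\in\mathcal{P}$ with $q\le f(p)\le T_\delta(q)$. Respects joins: a map of posets $f\colon\mathcal{L}\to\mathcal{Q}$ from a poset $\mathcal{L}$ with arbitrary joins (including the empty one) respects joins if for every $S\subseteq\mathcal{L}$ and $q\in\mathcal{Q}$ with $f(x)\le q$ for all $x\in S$, one has $f(\bigvee S)\le q$. Weak interleavings over $\mathcal{Q}$: $(M)^\varepsilon_{\mathcal{Q}}=M\circ T_\varepsilon$ (with $\varphi^\varepsilon=T_\varepsilon^*\varphi$). The internal maps of $M$ give natural maps $\eta^\varepsilon_{\mathcal{Q}}\colon M\to(M)^\varepsilon_{\mathcal{Q}}$, $\eta^{\varepsilon,\varepsilon'}_{\mathcal{Q}}\colon(M)^\varepsilon_{\mathcal{Q}}\to(M)^{\varepsilon'}_{\mathcal{Q}}$ for $\varepsilon\le\varepsilon'$, and $\Sigma^{\varepsilon_1,\varepsilon_2}_{\mathcal{Q}}\colon((M)^{\varepsilon_1}_{\mathcal{Q}})^{\varepsilon_2}_{\mathcal{Q}}\to(M)^{\varepsilon_1+\varepsilon_2}_{\mathcal{Q}}$. A weak $\varepsilon$-interleaving of $M,N$ is a pair $\varphi\colon M\to(N)^\varepsilon_{\mathcal{Q}}$,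 $\psi\colon N\to(M)^\varepsilon_{\mathcal{Q}}$ with $\Sigma^{\varepsilon,\varepsilon}_{\mathcal{Q}}\circ\psi^\varepsilon\circ\varphi=\eta^{0,2\varepsilon}_{\mathcal{Q}}\circ\eta^0_{\mathcal{Q}}$ on $M$ and symmetrically on $N$. $d_{\mathcal{Q}}(M,N)$ is the infimum of $\varepsilon\ge0$ for which one exists ($\infty$ if none). Weak interleavings relative to $f\colon\mathcal{P}\to\mathcal{Q}$ (here $\mathcal{P}=\mathcal{L}$): $(M)^\varepsilon_{\mathcal{P}}=f^*T_\varepsilon^*f_*M$ (with $\varphi^\varepsilon=f^*T_\varepsilon^*f_*\varphi$). Let $\eta^\varepsilon_{\mathcal{P}}$ be $M\xrightarrow{\upsilon}f^*f_*M\xrightarrow{f^*\eta^\varepsilon_{\mathcal{Q}}}f^*T_\varepsilon^*f_*M$, $\eta^{\varepsilon,\varepsilon'}_{\mathcal{P}}=f^*\eta^{\varepsilon,\varepsilon'}_{\mathcal{Q}}f_*$, and $\Sigma^{\varepsilon_1,\varepsilon_2}_{\mathcal{P}}$ the composite $$f^*T_{\varepsilon_2}^*f_*f^*T_{\varepsilon_1}^*f_*M\xrightarrow{f^*T_{\varepsilon_2}^*\chi}f^*T_{\varepsilon_2}^*T_{\varepsilon_1}^*f_*M\xrightarrow{f^*\Sigma_{\mathcal{Q}}^{\varepsilon_1,\varepsilon_2}}f^*T_{\varepsilon_1+\varepsilon_2}^*f_*M.$$ A weak $\varepsilon$-interleaving relative to $f$ of $M,N$ is a pair $\varphi\colon M\to(N)^\varepsilon_{\mathcal{P}}$,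 $\psi\colon N\to(M)^\varepsilon_{\mathcal{P}}$ with $\Sigma^{\varepsilon,\varepsilon}_{\mathcal{P}}\circ\psi^\varepsilon\circ\varphi=\eta^{0,2\varepsilon}_{\mathcal{P}}\circ\eta^0_{\mathcal{P}}$ on $M$ and symmetrically on $N$. $d_f(M,N)$ is the infimum of $\varepsilon\ge0$ for which one exists ($\infty$ if none). Distances take values in $[0,\infty]$; an inequality $|a-b|\le c$ means $a\le b+c$ and $b\le a+c$. *)

theory Defs
  imports Complex_Main "HOL-Library.Extended_Nonnegative_Real"
begin

section \<open>Categories, functors, colimits\<close>

record ('o, 'a) cat =
  Obj :: "'o set"
  Arr :: "'a set"
  Dom :: "'a \<Rightarrow> 'o"
  Cod :: "'a \<Rightarrow> 'o"
  Ide :: "'o \<Rightarrow> 'a"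
  Cmp :: "'a \<Rightarrow> 'a \<Rightarrow> 'a"  (infixl \<open>\<cdot>\<index>\<close> 70)

text \<open>Composition is in the usual order: \<open>g \<cdot>\<^bsub>C\<^esub> f\<close> is ``first \<open>f\<close>, then \<open>g\<close>''.\<close>

definition hom :: "('o, 'a) cat \<Rightarrow> 'o \<Rightarrow> 'o \<Rightarrow> 'a set" where
  "hom C x y = {u \<in> Arr C. Dom C u = x \<and> Cod C u = y}"

definition category :: "('o, 'a) cat \<Rightarrow> bool" where
  "category C \<longleftrightarrow>
     (\<forall>u\<in>Arr C. Dom C u \<in> Obj C \<and> Cod C u \<in> Obj C) \<and>
     (\<forall>x\<in>Obj C. Ide C x \<in> hom C x x) \<and>
     (\<forall>u\<in>Arr C. \<forall>v\<in>Arr C. Cod C u = Dom C v \<longrightarrow> v \<cdot>\<^bsub>C\<^esub> u \<in> hom C (Dom C u) (Cod C v)) \<and>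
     (\<forall>u\<in>Arr C. u \<cdot>\<^bsub>C\<^esub> Ide C (Dom C u) = u \<and> Ide C (Cod C u) \<cdot>\<^bsub>C\<^esub> u = u) \<and>
     (\<forall>u\<in>Arr C. \<forall>v\<in>Arr C. \<forall>w\<in>Arr C. Cod C u = Dom C v \<and> Cod C v = Dom C w \<longrightarrow>
        w \<cdot>\<^bsub>C\<^esub> (v \<cdot>\<^bsub>C\<^esub> u) = (w \<cdot>\<^bsub>C\<^esub> v) \<cdot>\<^bsub>C\<^esub> u)"

record ('i, 'j, 'o, 'a) funct =
  FObj :: "'i \<Rightarrow> 'o"
  FArr :: "'j \<Rightarrow> 'a"

definition is_functor :: "('i, 'j) cat \<Rightarrow> ('o, 'a) cat \<Rightarrow> ('i, 'j, 'o, 'a) funct \<Rightarrow> bool" where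
  "is_functor J C F \<longleftrightarrow>
     (\<forall>x\<in>Obj J. FObj F x \<in> Obj C) \<and>
     (\<forall>u\<in>Arr J. FArr F u \<in> hom C (FObj F (Dom J u)) (FObj F (Cod J u))) \<and>
     (\<forall>x\<in>Obj J. FArr F (Ide J x) = Ide C (FObj F x)) \<and>
     (\<forall>u\<in>Arr J. \<forall>v\<in>Arr J. Cod J u = Dom J v \<longrightarrow>
        FArr F (v \<cdot>\<^bsub>J\<^esub> u) = FArr F v \<cdot>\<^bsub>C\<^esub> FArr F u)"

definition nat_trans ::
  "('i, 'j) cat \<Rightarrow> ('o, 'a) cat \<Rightarrow> ('i, 'j, 'o, 'a) funct \<Rightarrow> ('i, 'j, 'o, 'a) funct \<Rightarrow>
   ('i \<Rightarrow> 'a) \<Rightarrow> bool" where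
  "nat_trans J C F G \<alpha> \<longleftrightarrow>
     (\<forall>x\<in>Obj J. \<alpha> x \<in> hom C (FObj F x) (FObj G x)) \<and>
     (\<forall>u\<in>Arr J. \<alpha> (Cod J u) \<cdot>\<^bsub>C\<^esub> FArr F u = FArr G u \<cdot>\<^bsub>C\<^esub> \<alpha> (Dom J u))"

definition vcomp :: "('o, 'a) cat \<Rightarrow> ('i \<Rightarrow> 'a) \<Rightarrow> ('i \<Rightarrow> 'a) \<Rightarrow> 'i \<Rightarrow> 'a" where
  "vcomp C \<beta> \<alpha> = (\<lambda>x. \<beta> x \<cdot>\<^bsub>C\<^esub> \<alpha> x)"

text \<open>A cocone is a pair consisting of its apex and its family of legs.\<close>

definition is_cocone ::
  "('i, 'j) cat \<Rightarrow> ('o, 'a) cat \<Rightarrow> ('i, 'j, 'o, 'a) funct \<Rightarrow> 'o \<times> ('i \<Rightarrow> 'a) \<Rightarrow> bool" where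
  "is_cocone J C D K \<longleftrightarrow>
     fst K \<in> Obj C \<and>
     (\<forall>j\<in>Obj J. snd K j \<in> hom C (FObj D j) (fst K)) \<and>
     (\<forall>u\<in>Arr J. snd K (Cod J u) \<cdot>\<^bsub>C\<^esub> FArr D u = snd K (Dom J u))"

definition cocone_map ::
  "('i, 'j) cat \<Rightarrow> ('o, 'a) cat \<Rightarrow> 'o \<times> ('i \<Rightarrow> 'a) \<Rightarrow> 'o \<times> ('i \<Rightarrow> 'a) \<Rightarrow> 'a \<Rightarrow> bool" where
  "cocone_map J C K K' u \<longleftrightarrow>
     u \<in> hom C (fst K) (fst K') \<and> (\<forall>j\<in>Obj J. u \<cdot>\<^bsub>C\<^esub> snd K j = snd K' j)"

definition is_colimit ::
  "('i, 'j) cat \<Rightarrow> ('o, 'a) cat \<Rightarrow> ('i, 'j, 'o, 'a) funct \<Rightarrow> 'o \<times> ('i \<Rightarrow> 'a) \<Rightarrow> bool" where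
  "is_colimit J C D K \<longleftrightarrow>
     is_cocone J C D K \<and> (\<forall>K'. is_cocone J C D K' \<longrightarrow> (\<exists>!u. cocone_map J C K K' u))"

text \<open>
  Cocompleteness: every small diagram has a colimit. HOL cannot quantify over all types of
  indices inside a formula, so ``small'' is a parameter: a category is small if its objects
  and arrows are drawn from the given types \<open>'i\<close> and \<open>'j\<close>.
\<close>

definition cocomplete :: "'i itself \<Rightarrow> 'j itself \<Rightarrow> ('o, 'a) cat \<Rightarrow> bool" where
  "cocomplete _ _ C \<longleftrightarrow>
     (\<forall>(J :: ('i, 'j) cat) D. category J \<and> is_functor J C D \<longrightarrow> (\<exists>K. is_colimit J C D K))"

definition colim ::
  "('i, 'j) cat \<Rightarrow> ('o, 'a) cat \<Rightarrow> ('i, 'j, 'o, 'a) funct \<Rightarrow> 'o \<times> ('i \<Rightarrow> 'a)" where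
  "colim J C D = (SOME K. is_colimit J C D K)"

definition colim_desc ::
  "('i, 'j) cat \<Rightarrow> ('o, 'a) cat \<Rightarrow> ('i, 'j, 'o, 'a) funct \<Rightarrow> 'o \<times> ('i \<Rightarrow> 'a) \<Rightarrow> 'a" where
  "colim_desc J C D K' = (THE u. cocone_map J C (colim J C D) K' u)"

section \<open>Modules over posets\<close>

text \<open>A subset of a poset as a category: there is a unique arrow \<open>(x, y)\<close> whenever \<open>x \<le> y\<close>.\<close>

definition poset_cat :: "'p::order set \<Rightarrow> ('p, 'p \<times> 'p) cat" where
  "poset_cat S =
     \<lparr>Obj = S, Arr = {(x, y). x \<in> S \<and> y \<in> S \<and> x \<le> y}, Dom = fst, Cod = snd,
      Ide = (\<lambda>x. (x, x)), Cmp = (\<lambda>v u. (fst u, snd v))\<rparr>"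

type_synonym ('p, 'o, 'a) pmod = "('p, 'p \<times> 'p, 'o, 'a) funct"

abbreviation is_module :: "('o, 'a) cat \<Rightarrow> ('p::order, 'o, 'a) pmod \<Rightarrow> bool" where
  "is_module C M \<equiv> is_functor (poset_cat UNIV) C M"

abbreviation module_map ::
  "('o, 'a) cat \<Rightarrow> ('p::order, 'o, 'a) pmod \<Rightarrow> ('p, 'o, 'a) pmod \<Rightarrow> ('p \<Rightarrow> 'a) \<Rightarrow> bool" where
  "module_map C M N \<phi> \<equiv> nat_trans (poset_cat UNIV) C M N \<phi>"

text \<open>On a module map \<open>\<phi>\<close>, the pullback functor \<open>f\<^sup>*\<close> is just \<open>\<phi> \<circ> f\<close>.\<close>

definition pullback :: "('p \<Rightarrow> 'q) \<Rightarrow> ('q, 'o, 'a) pmod \<Rightarrow> ('p, 'o, 'a) pmod" where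
  "pullback f M = \<lparr>FObj = (\<lambda>p. FObj M (f p)), FArr = (\<lambda>(x, y). FArr M (f x, f y))\<rparr>"

section \<open>Pushforward: the pointwise left Kan extension, its unit and counit\<close>

definition slice :: "('p::order \<Rightarrow> 'q::order) \<Rightarrow> 'q \<Rightarrow> ('p, 'p \<times> 'p) cat" where
  "slice f q = poset_cat {p. f p \<le> q}"

abbreviation lan_colim ::
  "('o, 'a) cat \<Rightarrow> ('p::order \<Rightarrow> 'q::order) \<Rightarrow> ('p, 'o, 'a) pmod \<Rightarrow> 'q \<Rightarrow> 'o \<times> ('p \<Rightarrow> 'a)" where
  "lan_colim C f M q \<equiv> colim (slice f q) C M"

definition pushforward ::
  "('o, 'a) cat \<Rightarrow> ('p::order \<Rightarrow> 'q::order) \<Rightarrow> ('p, 'o, 'a) pmod \<Rightarrow> ('q, 'o, 'a) pmod" where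
  "pushforward C f M =
     \<lparr>FObj = (\<lambda>q. fst (lan_colim C f M q)),
      FArr = (\<lambda>(q, q'). colim_desc (slice f q) C M (lan_colim C f M q'))\<rparr>"

definition pushforward_map ::
  "('o, 'a) cat \<Rightarrow> ('p::order \<Rightarrow> 'q::order) \<Rightarrow> ('p, 'o, 'a) pmod \<Rightarrow> ('p, 'o, 'a) pmod \<Rightarrow>
   ('p \<Rightarrow> 'a) \<Rightarrow> 'q \<Rightarrow> 'a" where
  "pushforward_map C f M N \<phi> q =
     colim_desc (slice f q) C M
       (fst (lan_colim C f N q), \<lambda>p. snd (lan_colim C f N q) p \<cdot>\<^bsub>C\<^esub> \<phi> p)"

text \<open>The unit \<open>M \<Rightarrow> f\<^sup>*f\<^sub>*M\<close> at \<open>p\<close> is the leg at \<open>p\<close> of the colimit computing \<open>f\<^sub>*M\<close> at \<open>f p\<close>.\<close>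

definition lan_unit ::
  "('o, 'a) cat \<Rightarrow> ('p::order \<Rightarrow> 'q::order) \<Rightarrow> ('p, 'o, 'a) pmod \<Rightarrow> 'p \<Rightarrow> 'a" where
  "lan_unit C f M p = snd (lan_colim C f M (f p)) p"

text \<open>
  The counit \<open>f\<^sub>*f\<^sup>*N \<Rightarrow> N\<close> at \<open>q\<close> is induced by the internal maps from \<open>N (f p)\<close> to \<open>N q\<close> for
  \<open>f p \<le> q\<close>.
\<close>

definition lan_counit ::
  "('o, 'a) cat \<Rightarrow> ('p::order \<Rightarrow> 'q::order) \<Rightarrow> ('q, 'o, 'a) pmod \<Rightarrow> 'q \<Rightarrow> 'a" where
  "lan_counit C f N q =
     colim_desc (slice f q) C (pullback f N) (FObj N q, \<lambda>p. FArr N (f p, q))"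

section \<open>Translations\<close>

definition translation :: "('q::order \<Rightarrow> 'q) \<Rightarrow> bool" where
  "translation t \<longleftrightarrow> mono t \<and> (\<forall>q. q \<le> t q)"

text \<open>Families of translations are indexed by the reals; only indices \<open>\<ge> 0\<close> are meaningful.\<close>

definition superlinear_family :: "(real \<Rightarrow> 'q::order \<Rightarrow> 'q) \<Rightarrow> bool" where
  "superlinear_family T \<longleftrightarrow>
     (\<forall>\<epsilon>\<ge>0. translation (T \<epsilon>)) \<and>
     (\<forall>\<epsilon>\<^sub>1\<ge>0. \<forall>\<epsilon>\<^sub>2\<ge>0. \<forall>q. T \<epsilon>\<^sub>2 (T \<epsilon>\<^sub>1 q) \<le> T (\<epsilon>\<^sub>1 + \<epsilon>\<^sub>2) q)"

definition delta_approximation ::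
  "(real \<Rightarrow> 'q::order \<Rightarrow> 'q) \<Rightarrow> real \<Rightarrow> ('p::order \<Rightarrow> 'q) \<Rightarrow> bool" where
  "delta_approximation T \<delta> f \<longleftrightarrow> mono f \<and> (\<forall>q. \<exists>p. q \<le> f p \<and> f p \<le> T \<delta> q)"

definition respects_joins :: "('l::complete_lattice \<Rightarrow> 'q::order) \<Rightarrow> bool" where
  "respects_joins f \<longleftrightarrow> mono f \<and> (\<forall>S q. (\<forall>x\<in>S. f x \<le> q) \<longrightarrow> f (Sup S) \<le> q)"

section \<open>Weak interleavings over \<open>\<Q>\<close>\<close>

text \<open>On a module map \<open>\<phi>\<close>, the shift by \<open>\<epsilon>\<close> is \<open>\<phi> \<circ> T \<epsilon>\<close>.\<close>

definition shiftQ ::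
  "(real \<Rightarrow> 'q \<Rightarrow> 'q) \<Rightarrow> real \<Rightarrow> ('q, 'o, 'a) pmod \<Rightarrow> ('q, 'o, 'a) pmod" where
  "shiftQ T \<epsilon> M = pullback (T \<epsilon>) M"

definition etaQ :: "(real \<Rightarrow> 'q \<Rightarrow> 'q) \<Rightarrow> real \<Rightarrow> ('q, 'o, 'a) pmod \<Rightarrow> 'q \<Rightarrow> 'a" where
  "etaQ T \<epsilon> M q = FArr M (q, T \<epsilon> q)"

definition etaQ2 ::
  "(real \<Rightarrow> 'q \<Rightarrow> 'q) \<Rightarrow> real \<Rightarrow> real \<Rightarrow> ('q, 'o, 'a) pmod \<Rightarrow> 'q \<Rightarrow> 'a" where
  "etaQ2 T \<epsilon> \<epsilon>' M q = FArr M (T \<epsilon> q, T \<epsilon>' q)"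

definition SigmaQ ::
  "(real \<Rightarrow> 'q \<Rightarrow> 'q) \<Rightarrow> real \<Rightarrow> real \<Rightarrow> ('q, 'o, 'a) pmod \<Rightarrow> 'q \<Rightarrow> 'a" where
  "SigmaQ T \<epsilon>\<^sub>1 \<epsilon>\<^sub>2 M q = FArr M (T \<epsilon>\<^sub>1 (T \<epsilon>\<^sub>2 q), T (\<epsilon>\<^sub>1 + \<epsilon>\<^sub>2) q)"

definition weak_interleavingQ ::
  "('o, 'a) cat \<Rightarrow> (real \<Rightarrow> 'q::order \<Rightarrow> 'q) \<Rightarrow> real \<Rightarrow> ('q, 'o, 'a) pmod \<Rightarrow> ('q, 'o, 'a) pmod \<Rightarrow>
   ('q \<Rightarrow> 'a) \<Rightarrow> ('q \<Rightarrow> 'a) \<Rightarrow> bool" where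
  "weak_interleavingQ C T \<epsilon> M N \<phi> \<psi> \<longleftrightarrow>
     module_map C M (shiftQ T \<epsilon> N) \<phi> \<and>
     module_map C N (shiftQ T \<epsilon> M) \<psi> \<and>
     vcomp C (SigmaQ T \<epsilon> \<epsilon> M) (vcomp C (\<psi> \<circ> T \<epsilon>) \<phi>) = vcomp C (etaQ2 T 0 (2 * \<epsilon>) M) (etaQ T 0 M) \<and>
     vcomp C (SigmaQ T \<epsilon> \<epsilon> N) (vcomp C (\<phi> \<circ> T \<epsilon>) \<psi>) = vcomp C (etaQ2 T 0 (2 * \<epsilon>) N) (etaQ T 0 N)"

definition distQ ::
  "('o, 'a) cat \<Rightarrow> (real \<Rightarrow> 'q::order \<Rightarrow> 'q) \<Rightarrow> ('q, 'o, 'a) pmod \<Rightarrow> ('q, 'o, 'a) pmod \<Rightarrow> ennreal" where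
  "distQ C T M N = Inf {ennreal \<epsilon> |\<epsilon>. \<epsilon> \<ge> 0 \<and> (\<exists>\<phi> \<psi>. weak_interleavingQ C T \<epsilon> M N \<phi> \<psi>)}"

section \<open>Weak interleavings relative to \<open>f\<close>\<close>

definition shiftP ::
  "('o, 'a) cat \<Rightarrow> ('p::order \<Rightarrow> 'q::order) \<Rightarrow> (real \<Rightarrow> 'q \<Rightarrow> 'q) \<Rightarrow> real \<Rightarrow>
   ('p, 'o, 'a) pmod \<Rightarrow> ('p, 'o, 'a) pmod" where
  "shiftP C f T \<epsilon> M = pullback f (shiftQ T \<epsilon> (pushforward C f M))"

definition shiftP_map ::
  "('o, 'a) cat \<Rightarrow> ('p::order \<Rightarrow> 'q::order) \<Rightarrow> (real \<Rightarrow> 'q \<Rightarrow> 'q) \<Rightarrow> real \<Rightarrow>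
   ('p, 'o, 'a) pmod \<Rightarrow> ('p, 'o, 'a) pmod \<Rightarrow> ('p \<Rightarrow> 'a) \<Rightarrow> 'p \<Rightarrow> 'a" where
  "shiftP_map C f T \<epsilon> M N \<phi> = pushforward_map C f M N \<phi> \<circ> T \<epsilon> \<circ> f"

definition etaP ::
  "('o, 'a) cat \<Rightarrow> ('p::order \<Rightarrow> 'q::order) \<Rightarrow> (real \<Rightarrow> 'q \<Rightarrow> 'q) \<Rightarrow> real \<Rightarrow>
   ('p, 'o, 'a) pmod \<Rightarrow> 'p \<Rightarrow> 'a" where
  "etaP C f T \<epsilon> M = vcomp C (etaQ T \<epsilon> (pushforward C f M) \<circ> f) (lan_unit C f M)"

definition etaP2 ::
  "('o, 'a) cat \<Rightarrow> ('p::order \<Rightarrow> 'q::order) \<Rightarrow> (real \<Rightarrow> 'q \<Rightarrow> 'q) \<Rightarrow> real \<Rightarrow> real \<Rightarrow>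
   ('p, 'o, 'a) pmod \<Rightarrow> 'p \<Rightarrow> 'a" where
  "etaP2 C f T \<epsilon> \<epsilon>' M = etaQ2 T \<epsilon> \<epsilon>' (pushforward C f M) \<circ> f"

definition SigmaP ::
  "('o, 'a) cat \<Rightarrow> ('p::order \<Rightarrow> 'q::order) \<Rightarrow> (real \<Rightarrow> 'q \<Rightarrow> 'q) \<Rightarrow> real \<Rightarrow> real \<Rightarrow>
   ('p, 'o, 'a) pmod \<Rightarrow> 'p \<Rightarrow> 'a" where
  "SigmaP C f T \<epsilon>\<^sub>1 \<epsilon>\<^sub>2 M =
     vcomp C (SigmaQ T \<epsilon>\<^sub>1 \<epsilon>\<^sub>2 (pushforward C f M) \<circ> f)
             (lan_counit C f (shiftQ T \<epsilon>\<^sub>1 (pushforward C f M)) \<circ> T \<epsilon>\<^sub>2 \<circ> f)"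

definition weak_interleavingP ::
  "('o, 'a) cat \<Rightarrow> ('p::order \<Rightarrow> 'q::order) \<Rightarrow> (real \<Rightarrow> 'q \<Rightarrow> 'q) \<Rightarrow> real \<Rightarrow>
   ('p, 'o, 'a) pmod \<Rightarrow> ('p, 'o, 'a) pmod \<Rightarrow> ('p \<Rightarrow> 'a) \<Rightarrow> ('p \<Rightarrow> 'a) \<Rightarrow> bool" where
  "weak_interleavingP C f T \<epsilon> M N \<phi> \<psi> \<longleftrightarrow>
     module_map C M (shiftP C f T \<epsilon> N) \<phi> \<and>
     module_map C N (shiftP C f T \<epsilon> M) \<psi> \<and>
     vcomp C (SigmaP C f T \<epsilon> \<epsilon> M) (vcomp C (shiftP_map C f T \<epsilon> N (shiftP C f T \<epsilon> M) \<psi>) \<phi>) =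
       vcomp C (etaP2 C f T 0 (2 * \<epsilon>) M) (etaP C f T 0 M) \<and>
     vcomp C (SigmaP C f T \<epsilon> \<epsilon> N) (vcomp C (shiftP_map C f T \<epsilon> M (shiftP C f T \<epsilon> N) \<phi>) \<psi>) =
       vcomp C (etaP2 C f T 0 (2 * \<epsilon>) N) (etaP C f T 0 N)"

definition distP ::
  "('o, 'a) cat \<Rightarrow> ('p::order \<Rightarrow> 'q::order) \<Rightarrow> (real \<Rightarrow> 'q \<Rightarrow> 'q) \<Rightarrow>
   ('p, 'o, 'a) pmod \<Rightarrow> ('p, 'o, 'a) pmod \<Rightarrow> ennreal" where
  "distP C f T M N = Inf {ennreal \<epsilon> |\<epsilon>. \<epsilon> \<ge> 0 \<and> (\<exists>\<phi> \<psi>. weak_interleavingP C f T \<epsilon> M N \<phi> \<psi>)}"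

end

theory Submission
  imports Defs
begin

text \<open>
  A map \<open>f\<close> that respects joins has a right adjoint, \<open>g q = \<Squnion>{p. f p \<le> q}\<close>: the join of all \<open>p\<close>
  with \<open>f p \<le> q\<close> again satisfies \<open>f (g q) \<le> q\<close>, so that \<open>f p \<le> q\<close> if and only if \<open>p \<le> g q\<close>. Hence
  the poset \<open>{p. f p \<le> q}\<close> has the greatest element \<open>g q\<close>, and the colimit that defines \<open>f\<^sub>*A\<close> at \<open>q\<close>
  is canonically isomorphic to \<open>A (g q)\<close>, by the leg of the colimit cocone at \<open>g q\<close>
  (\<open>top_leg_inverse\<close>, \<open>pushforward_arr_top_leg\<close>). In short, \<open>f\<^sub>* \<cong> g\<^sup>*\<close>.

  Under this isomorphism the relative shift \<open>f\<^sup>*T\<^sub>\<epsilon>\<^sup>*f\<^sub>*A\<close> becomes \<open>A \<circ> S\<^sub>\<epsilon>\<close> for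
  \<open>S\<^sub>\<epsilon> = g \<circ> T\<^sub>\<epsilon> \<circ> f\<close>. The family \<open>S\<close> is a superlinear family of translations of the domain of
  \<open>f\<close>, and interleavings relative to \<open>f\<close> are the same as ordinary interleavings with respect to
  \<open>S\<close> (\<open>weak_interleavingP_iff_transport\<close>). No colimit occurs beyond this point.

  It remains to compare interleavings of \<open>M, N\<close> along \<open>T\<close> with interleavings of \<open>f\<^sup>*M, f\<^sup>*N\<close> along
  \<open>S\<close>. Being a \<open>\<delta>\<close>-approximation now amounts to \<open>q \<le> f (g (T\<^sub>\<delta> q)) \<le> T\<^sub>\<delta> q\<close>: rounding \<open>T\<^sub>\<delta> q\<close> down to the
  image of \<open>f\<close> does not go below \<open>q\<close>. So an \<open>\<epsilon>\<close>-interleaving along \<open>T\<close> restricts to an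
  \<open>(\<epsilon> + \<delta>)\<close>-interleaving along \<open>S\<close>, by following \<open>M (f p) \<rightarrow> N (T\<^sub>\<epsilon> (f p))\<close> with the internal map to
  \<open>N (f (S\<^bsub>\<epsilon>+\<delta>\<^esub> p))\<close>; and an \<open>\<epsilon>\<close>-interleaving along \<open>S\<close> extends to an \<open>(\<epsilon> + \<delta>)\<close>-interleaving
  along \<open>T\<close>, by first moving from \<open>q\<close> up to the nearby image point \<open>f (g (T\<^sub>\<delta> q))\<close>. Each time the
  interleaving equation follows by naturality, because any two composites of internal maps with
  the same ends agree. Both estimates lose only \<open>\<delta>\<close>, so the distances differ by at most \<open>2\<delta>\<close>.
\<close>

section \<open>Composition in the target category\<close>

locale target_category =
  fixes C :: "('o, 'a) cat" (structure)
  assumes category: "category C"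
begin

lemma comp_arr:
  assumes "u \<in> Arr C" "v \<in> Arr C" "Cod C u = Dom C v"
  shows comp_in_Arr: "v \<cdot> u \<in> Arr C" and comp_Dom: "Dom C (v \<cdot> u) = Dom C u"
    and comp_Cod: "Cod C (v \<cdot> u) = Cod C v"
  using category assms unfolding category_def hom_def by auto

lemma comp_assoc:
  assumes "u \<in> Arr C" "v \<in> Arr C" "w \<in> Arr C" "Cod C u = Dom C v" "Cod C v = Dom C w"
  shows "(w \<cdot> v) \<cdot> u = w \<cdot> (v \<cdot> u)"
  using category assms unfolding category_def by auto

lemma comp_Ide:
  assumes "u \<in> Arr C"
  shows "Dom C u = x \<Longrightarrow> u \<cdot> Ide C x = u" and "Cod C u = x \<Longrightarrow> Ide C x \<cdot> u = u"
  using category assms unfolding category_def by auto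

lemma Ide_arr:
  assumes "x \<in> Obj C"
  shows "Ide C x \<in> Arr C" "Dom C (Ide C x) = x" "Cod C (Ide C x) = x"
  using category assms unfolding category_def hom_def by auto

lemma module_obj: "is_module C M \<Longrightarrow> FObj M x \<in> Obj C"
  by (simp add: is_functor_def poset_cat_def)

lemma module_arr:
  assumes "is_module C M" "x \<le> y"
  shows "FArr M (x, y) \<in> Arr C" "Dom C (FArr M (x, y)) = FObj M x"
    "Cod C (FArr M (x, y)) = FObj M y"
proof -
  have "\<forall>u\<in>Arr (poset_cat UNIV). FArr M u
      \<in> hom C (FObj M (Dom (poset_cat UNIV) u)) (FObj M (Cod (poset_cat UNIV) u))"
    using assms(1) unfolding is_functor_def by blast
  from bspec[OF this, of "(x, y)"] assms(2)
  show "FArr M (x, y) \<in> Arr C" "Dom C (FArr M (x, y)) = FObj M x"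
    "Cod C (FArr M (x, y)) = FObj M y"
    by (auto simp: poset_cat_def hom_def)
qed

lemma module_Ide:
  assumes "is_module C M"
  shows "FArr M (x, x) = Ide C (FObj M x)"
proof -
  have "\<forall>x\<in>Obj (poset_cat UNIV). FArr M (Ide (poset_cat UNIV) x) = Ide C (FObj M x)"
    using assms(1) unfolding is_functor_def by blast
  from bspec[OF this, of x] show ?thesis by (simp add: poset_cat_def)
qed

lemma module_comp:
  assumes "is_module C M" "x \<le> y" "y \<le> z"
  shows "FArr M (y, z) \<cdot> FArr M (x, y) = FArr M (x, z)"
proof -
  have "\<forall>u\<in>Arr (poset_cat UNIV). \<forall>v\<in>Arr (poset_cat UNIV).
      Cod (poset_cat UNIV) u = Dom (poset_cat UNIV) v \<longrightarrow>
      FArr M (v \<cdot>\<^bsub>poset_cat UNIV\<^esub> u) = FArr M v \<cdot> FArr M u"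
    using assms(1) unfolding is_functor_def by blast
  from bspec[OF bspec[OF this, of "(x, y)"], of "(y, z)"] assms(2,3)
  show ?thesis by (simp add: poset_cat_def)
qed

lemma module_comp_left:
  assumes "is_module C M" "x \<le> y" "y \<le> z" "u \<in> Arr C" "Cod C u = FObj M x"
  shows "FArr M (y, z) \<cdot> (FArr M (x, y) \<cdot> u) = FArr M (x, z) \<cdot> u"
  using comp_assoc[of u "FArr M (x, y)" "FArr M (y, z)"] assms
  by (simp add: module_arr module_comp)

lemma is_moduleI:
  assumes "\<And>x. FObj M x \<in> Obj C"
    and "\<And>x y. x \<le> y \<Longrightarrow> FArr M (x, y) \<in> hom C (FObj M x) (FObj M y)"
    and "\<And>x. FArr M (x, x) = Ide C (FObj M x)"
    and "\<And>x y z. x \<le> y \<Longrightarrow> y \<le> z \<Longrightarrow> FArr M (y, z) \<cdot> FArr M (x, y) = FArr M (x, z)"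
  shows "is_module C M"
  using assms by (auto simp: is_functor_def poset_cat_def)

lemma pullback_module:
  assumes "is_module C M" "mono t"
  shows "is_module C (pullback t M)"
  using assms
  by (intro is_moduleI)
    (auto simp: pullback_def module_obj module_arr module_Ide module_comp hom_def monoD)

lemma shifted_map_arr:
  assumes "module_map C M (shiftQ T \<epsilon> N) \<phi>"
  shows "\<phi> x \<in> Arr C" "Dom C (\<phi> x) = FObj M x" "Cod C (\<phi> x) = FObj N (T \<epsilon> x)"
  using assms by (auto simp: nat_trans_def poset_cat_def hom_def shiftQ_def pullback_def)

lemma shifted_map_natural:
  assumes "module_map C M (shiftQ T \<epsilon> N) \<phi>" "x \<le> y"
  shows "\<phi> y \<cdot> FArr M (x, y) = FArr N (T \<epsilon> x, T \<epsilon> y) \<cdot> \<phi> x"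
  using assms by (fastforce simp: nat_trans_def poset_cat_def shiftQ_def pullback_def)

lemma shifted_mapI:
  assumes "\<And>x. \<phi> x \<in> hom C (FObj M x) (FObj N (T \<epsilon> x))"
    and "\<And>x y. x \<le> y \<Longrightarrow> \<phi> y \<cdot> FArr M (x, y) = FArr N (T \<epsilon> x, T \<epsilon> y) \<cdot> \<phi> x"
  shows "module_map C M (shiftQ T \<epsilon> N) \<phi>"
  using assms by (auto simp: nat_trans_def poset_cat_def shiftQ_def pullback_def)

text \<open>
  With typing expressed by \<open>Dom\<close> and \<open>Cod\<close> instead of hom-sets, simplification can check that a
  composite makes sense; \<open>arr_simps\<close> then associates composites to the right and merges adjacent
  internal maps of a module.
\<close>

lemmas arrow_rules = comp_in_Arr comp_Dom comp_Cod module_arr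

lemmas arr_simps = arrow_rules comp_assoc module_comp module_comp_left

text \<open>Half of the definition of a weak interleaving: going there and back from \<open>M\<close>.\<close>

definition round_trip ::
  "(real \<Rightarrow> 'p::order \<Rightarrow> 'p) \<Rightarrow> real \<Rightarrow> ('p, 'o, 'a) pmod \<Rightarrow> ('p \<Rightarrow> 'a) \<Rightarrow> ('p \<Rightarrow> 'a) \<Rightarrow> bool" where
  "round_trip T \<epsilon> M \<phi> \<psi> \<longleftrightarrow>
     (\<forall>x. FArr M (T \<epsilon> (T \<epsilon> x), T (2 * \<epsilon>) x) \<cdot> (\<psi> (T \<epsilon> x) \<cdot> \<phi> x) = FArr M (x, T (2 * \<epsilon>) x))"

end

lemma superlinear_familyD:
  assumes "superlinear_family T"
  shows "0 \<le> \<epsilon> \<Longrightarrow> x \<le> y \<Longrightarrow> T \<epsilon> x \<le> T \<epsilon> y"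
    and "0 \<le> \<epsilon> \<Longrightarrow> x \<le> T \<epsilon> x"
    and "0 \<le> \<epsilon>\<^sub>1 \<Longrightarrow> 0 \<le> \<epsilon>\<^sub>2 \<Longrightarrow> T \<epsilon>\<^sub>2 (T \<epsilon>\<^sub>1 x) \<le> T (\<epsilon>\<^sub>1 + \<epsilon>\<^sub>2) x"
  using assms by (auto simp: superlinear_family_def translation_def monoD)

text \<open>
  The increase of the index from \<open>\<alpha>\<close> to \<open>\<beta>\<close> is realised by the translation \<open>T (\<beta> - \<alpha>)\<close>.
\<close>

lemma superlinear_family_index_mono:
  assumes "superlinear_family T" "0 \<le> \<alpha>" "\<alpha> \<le> \<beta>"
  shows "T \<alpha> x \<le> T \<beta> x"
proof -
  have "T \<alpha> x \<le> T (\<beta> - \<alpha>) (T \<alpha> x)"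
    using superlinear_familyD(2)[OF assms(1), of "\<beta> - \<alpha>"] assms(3) by simp
  also have "\<dots> \<le> T (\<alpha> + (\<beta> - \<alpha>)) x"
    using superlinear_familyD(3)[OF assms(1), of \<alpha> "\<beta> - \<alpha>"] assms(2,3) by simp
  finally show ?thesis by simp
qed

lemma superlinear_family_twice:
  assumes "superlinear_family T" "0 \<le> \<epsilon>"
  shows "T \<epsilon> (T \<epsilon> x) \<le> T (2 * \<epsilon>) x"
  using superlinear_familyD(3)[OF assms(1), of \<epsilon> \<epsilon> x] assms(2) by simp

text \<open>
  The right-hand sides of the interleaving equations run through \<open>T 0 x\<close>; they collapse to single
  internal maps because \<open>x \<le> T 0 x \<le> T (2 * \<epsilon>) x\<close>.
\<close>

lemma (in target_category) weak_interleavingQ_iff_round_trip: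
  assumes "superlinear_family T" "0 \<le> \<epsilon>" "is_module C M" "is_module C N"
  shows "weak_interleavingQ C T \<epsilon> M N \<phi> \<psi> \<longleftrightarrow>
    module_map C M (shiftQ T \<epsilon> N) \<phi> \<and> module_map C N (shiftQ T \<epsilon> M) \<psi> \<and>
    round_trip T \<epsilon> M \<phi> \<psi> \<and> round_trip T \<epsilon> N \<psi> \<phi>"
proof -
  have "vcomp C (SigmaQ T \<epsilon> \<epsilon> K) (vcomp C (\<beta> \<circ> T \<epsilon>) \<alpha>)
      = vcomp C (etaQ2 T 0 (2 * \<epsilon>) K) (etaQ T 0 K) \<longleftrightarrow> round_trip T \<epsilon> K \<alpha> \<beta>"
    if "is_module C K" for K \<alpha> \<beta>
  proof -
    have "FArr K (T 0 x, T (2 * \<epsilon>) x) \<cdot> FArr K (x, T 0 x) = FArr K (x, T (2 * \<epsilon>) x)" for x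
      using superlinear_familyD(2)[OF assms(1), of 0 x]
        superlinear_family_index_mono[OF assms(1), of 0 "2 * \<epsilon>" x] assms(2)
      by (intro module_comp[OF that]) auto
    then show ?thesis
      by (simp add: round_trip_def vcomp_def SigmaQ_def etaQ2_def etaQ_def fun_eq_iff
          flip: mult_2)
  qed
  then show ?thesis
    unfolding weak_interleavingQ_def using assms(3,4) by blast
qed

section \<open>The pushforward along a left adjoint\<close>

locale adjoint_pushforward = target_category C
  for C :: "('o, 'a) cat" (structure) +
  fixes f :: "'p::order \<Rightarrow> 'q::order" and g :: "'q \<Rightarrow> 'p"
  assumes adjoint: "f p \<le> q \<longleftrightarrow> p \<le> g q"
begin

lemma unit_le: "p \<le> g (f p)" using adjoint by blast
lemma counit_le: "f (g q) \<le> q" using adjoint by blast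
lemma f_mono: "p \<le> p' \<Longrightarrow> f p \<le> f p'"
  by (simp add: adjoint order_trans[OF _ unit_le])
lemma g_mono: "q \<le> q' \<Longrightarrow> g q \<le> g q'"
  by (simp add: adjoint[symmetric] order_trans[OF counit_le])

text \<open>
  By adjointness, the objects of \<open>slice f q\<close> are the \<open>p \<le> g q\<close>.
\<close>

lemma slice_cocone_iff:
  "is_cocone (slice f q) C A K \<longleftrightarrow>
     fst K \<in> Obj C \<and> (\<forall>p. p \<le> g q \<longrightarrow> snd K p \<in> hom C (FObj A p) (fst K)) \<and>
     (\<forall>p p'. p \<le> p' \<longrightarrow> p' \<le> g q \<longrightarrow> snd K p' \<cdot> FArr A (p, p') = snd K p)"
  by (auto simp: is_cocone_def slice_def poset_cat_def adjoint)

lemma slice_cocone_map_iff: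
  "cocone_map (slice f q) C K K' u \<longleftrightarrow>
     u \<in> hom C (fst K) (fst K') \<and> (\<forall>p. p \<le> g q \<longrightarrow> u \<cdot> snd K p = snd K' p)"
  by (auto simp: cocone_map_def slice_def poset_cat_def adjoint)

text \<open>
  The diagram has the terminal index \<open>g q\<close>, so a cocone is determined by its leg there.
\<close>

lemma terminal_is_colimit:
  assumes "is_module C A"
  shows "is_colimit (slice f q) C A (FObj A (g q), \<lambda>p. FArr A (p, g q))"
  unfolding is_colimit_def
proof (intro conjI allI impI)
  show "is_cocone (slice f q) C A (FObj A (g q), \<lambda>p. FArr A (p, g q))"
    using assms by (auto simp: slice_cocone_iff arr_simps
        module_obj hom_def)
next
  fix K
  assume K: "is_cocone (slice f q) C A K"
  then have top: "snd K (g q) \<in> hom C (FObj A (g q)) (fst K)"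
    and legs: "\<And>p. p \<le> g q \<Longrightarrow> snd K (g q) \<cdot> FArr A (p, g q) = snd K p"
    by (auto simp: slice_cocone_iff)
  have "u = snd K (g q)"
    if "cocone_map (slice f q) C (FObj A (g q), \<lambda>p. FArr A (p, g q)) K u" for u
    using that assms by (auto simp: slice_cocone_map_iff module_Ide
        comp_Ide hom_def)
  moreover have "cocone_map (slice f q) C (FObj A (g q), \<lambda>p. FArr A (p, g q)) K (snd K (g q))"
    using top legs by (auto simp: slice_cocone_map_iff)
  ultimately show "\<exists>!u. cocone_map (slice f q) C (FObj A (g q), \<lambda>p. FArr A (p, g q)) K u"
    by blast
qed

lemma lan_colim_is_colimit:
  assumes "is_module C A"
  shows "is_colimit (slice f q) C A (lan_colim C f A q)"
  unfolding colim_def using terminal_is_colimit[OF assms] by (rule someI)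

lemma lan_desc:
  assumes "is_module C A" "is_cocone (slice f q) C A K"
  shows "colim_desc (slice f q) C A K \<in> hom C (fst (lan_colim C f A q)) (fst K)"
    and "p \<le> g q \<Longrightarrow> colim_desc (slice f q) C A K \<cdot> snd (lan_colim C f A q) p = snd K p"
proof -
  have "\<exists>!u. cocone_map (slice f q) C (lan_colim C f A q) K u"
    using lan_colim_is_colimit[OF assms(1)] assms(2) unfolding is_colimit_def by blast
  then have "cocone_map (slice f q) C (lan_colim C f A q) K (colim_desc (slice f q) C A K)"
    unfolding colim_desc_def by (rule theI')
  then show "colim_desc (slice f q) C A K \<in> hom C (fst (lan_colim C f A q)) (fst K)"
    and "p \<le> g q \<Longrightarrow> colim_desc (slice f q) C A K \<cdot> snd (lan_colim C f A q) p = snd K p"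
    by (auto simp: slice_cocone_map_iff)
qed

lemma lan_cocone:
  assumes "is_module C A"
  shows lan_obj: "fst (lan_colim C f A q) \<in> Obj C"
    and lan_leg: "p \<le> g q \<Longrightarrow>
      snd (lan_colim C f A q) p \<in> hom C (FObj A p) (fst (lan_colim C f A q))"
    and lan_leg_comp: "p \<le> p' \<Longrightarrow> p' \<le> g q \<Longrightarrow>
      snd (lan_colim C f A q) p' \<cdot> FArr A (p, p') = snd (lan_colim C f A q) p"
  using lan_colim_is_colimit[OF assms, of q]
  by (auto simp: is_colimit_def slice_cocone_iff)

text \<open>
  The comparison isomorphism from \<open>A (g q)\<close> to \<open>f\<^sub>*A\<close> at \<open>q\<close> and its inverse. The colimit defining
  \<open>f\<^sub>*A\<close> is an arbitrary choice, so the two objects are in general not equal.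
\<close>

definition top_leg where
  "top_leg A q = snd (lan_colim C f A q) (g q)"

definition top_leg_inv where
  "top_leg_inv A q = colim_desc (slice f q) C A (FObj A (g q), \<lambda>p. FArr A (p, g q))"

lemma top_leg_arr:
  assumes "is_module C A"
  shows "top_leg A q \<in> Arr C" "Dom C (top_leg A q) = FObj A (g q)"
    "Cod C (top_leg A q) = FObj (pushforward C f A) q"
  using lan_leg[OF assms, of "g q" q] by (auto simp: top_leg_def hom_def pushforward_def)

lemma lan_leg_eq_top_leg:
  assumes "is_module C A" "p \<le> g q"
  shows "snd (lan_colim C f A q) p = top_leg A q \<cdot> FArr A (p, g q)"
  using assms by (simp add: top_leg_def lan_leg_comp)

text \<open>
  All legs factor through \<open>top_leg\<close>, so maps out of \<open>f\<^sub>*A\<close> need only be compared there. This is how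
  every later identity between maps induced on colimits is checked.
\<close>

lemma lan_ext:
  assumes "is_module C A" "u \<in> hom C (FObj (pushforward C f A) q) z"
    and "v \<in> hom C (FObj (pushforward C f A) q) z" "u \<cdot> top_leg A q = v \<cdot> top_leg A q"
  shows "u = v"
proof -
  let ?K = "lan_colim C f A q"
  let ?L = "(z, \<lambda>p. u \<cdot> snd ?K p)"
  have legs: "u \<cdot> snd ?K p = v \<cdot> snd ?K p" if "p \<le> g q" for p
  proof -
    have "w \<cdot> snd ?K p = (w \<cdot> top_leg A q) \<cdot> FArr A (p, g q)"
      if "w \<in> hom C (FObj (pushforward C f A) q) z" for w
      using that \<open>p \<le> g q\<close> assms(1) by (simp add: lan_leg_eq_top_leg hom_def arr_simps top_leg_arr)
    then show ?thesis using assms by simp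
  qed
  have "z \<in> Obj C" using assms(2) category by (auto simp: hom_def category_def)
  then have "is_cocone (slice f q) C A ?L"
    using assms(1,2)
    by (auto simp: slice_cocone_iff lan_leg_eq_top_leg hom_def
        arr_simps top_leg_arr)
  then have "\<exists>!w. cocone_map (slice f q) C ?K ?L w"
    using lan_colim_is_colimit[OF assms(1)] unfolding is_colimit_def by blast
  moreover have "cocone_map (slice f q) C ?K ?L u" "cocone_map (slice f q) C ?K ?L v"
    using assms(2,3) legs
    by (auto simp: slice_cocone_map_iff pushforward_def)
  ultimately show ?thesis by blast
qed

lemma top_leg_inverse:
  assumes "is_module C A"
  shows top_leg_inv_hom: "top_leg_inv A q \<in> hom C (FObj (pushforward C f A) q) (FObj A (g q))"
    and top_leg_inv_left: "top_leg_inv A q \<cdot> top_leg A q = Ide C (FObj A (g q))"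
    and top_leg_inv_right: "top_leg A q \<cdot> top_leg_inv A q = Ide C (FObj (pushforward C f A) q)"
proof -
  have cocone: "is_cocone (slice f q) C A (FObj A (g q), \<lambda>p. FArr A (p, g q))"
    using terminal_is_colimit[OF assms] by (simp add: is_colimit_def)
  show hom: "top_leg_inv A q \<in> hom C (FObj (pushforward C f A) q) (FObj A (g q))"
    using lan_desc(1)[OF assms cocone] by (simp add: top_leg_inv_def pushforward_def)
  show left: "top_leg_inv A q \<cdot> top_leg A q = Ide C (FObj A (g q))"
    using lan_desc(2)[OF assms cocone, of "g q"] assms
    by (simp add: top_leg_inv_def top_leg_def module_Ide)
  have obj: "FObj (pushforward C f A) q \<in> Obj C"
    using lan_obj[OF assms] by (simp add: pushforward_def)
  show "top_leg A q \<cdot> top_leg_inv A q = Ide C (FObj (pushforward C f A) q)"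
    by (rule lan_ext[OF assms, where z = "FObj (pushforward C f A) q"])
      (use hom left obj assms in \<open>auto simp: hom_def arr_simps top_leg_arr comp_Ide Ide_arr\<close>)
qed

text \<open>
  The isomorphism \<open>A \<circ> g \<cong> f\<^sub>*A\<close> is natural in \<open>q\<close>. With \<open>pushforward_map_top_leg\<close> (naturality in
  \<open>A\<close>), \<open>lan_counit_top_leg\<close> and \<open>lan_unit_top_leg\<close>, it identifies the adjunction between \<open>f\<^sub>*\<close> and
  \<open>f\<^sup>*\<close> with the one given by precomposition with \<open>g\<close> and \<open>f\<close>.
\<close>

lemma pushforward_arr_hom:
  assumes "is_module C A" "q \<le> q'"
  shows "FArr (pushforward C f A) (q, q')
      \<in> hom C (FObj (pushforward C f A) q) (FObj (pushforward C f A) q')"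
    and pushforward_arr_top_leg:
      "FArr (pushforward C f A) (q, q') \<cdot> top_leg A q = top_leg A q' \<cdot> FArr A (g q, g q')"
proof -
  have sub: "p \<le> g q \<Longrightarrow> p \<le> g q'" for p
    using g_mono[OF assms(2)] by (rule order_trans[rotated])
  have cocone: "is_cocone (slice f q) C A (lan_colim C f A q')"
    using assms(1) sub
    by (auto simp: slice_cocone_iff lan_obj lan_leg lan_leg_comp)
  show "FArr (pushforward C f A) (q, q')
      \<in> hom C (FObj (pushforward C f A) q) (FObj (pushforward C f A) q')"
    using lan_desc(1)[OF assms(1) cocone] by (simp add: pushforward_def)
  show "FArr (pushforward C f A) (q, q') \<cdot> top_leg A q = top_leg A q' \<cdot> FArr A (g q, g q')"
    using lan_desc(2)[OF assms(1) cocone, of "g q"] lan_leg_eq_top_leg[OF assms(1), of "g q" q'] sub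
    by (simp add: pushforward_def top_leg_def)
qed

lemma pushforward_module:
  assumes "is_module C A"
  shows "is_module C (pushforward C f A)"
proof (rule is_moduleI)
  show obj: "FObj (pushforward C f A) x \<in> Obj C" for x
    using lan_obj[OF assms] by (simp add: pushforward_def)
  show hom: "FArr (pushforward C f A) (x, y)
      \<in> hom C (FObj (pushforward C f A) x) (FObj (pushforward C f A) y)" if "x \<le> y" for x y
    using pushforward_arr_hom(1)[OF assms that] .
  show "FArr (pushforward C f A) (x, x) = Ide C (FObj (pushforward C f A) x)" for x
    by (rule lan_ext[OF assms hom])
      (use assms obj pushforward_arr_top_leg[OF assms, of x x] in
        \<open>auto simp: hom_def Ide_arr comp_Ide top_leg_arr module_Ide\<close>)
  show "FArr (pushforward C f A) (y, z) \<cdot> FArr (pushforward C f A) (x, y)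
      = FArr (pushforward C f A) (x, z)"
    if le: "x \<le> y" "y \<le> z" for x y z
  proof (rule lan_ext[OF assms])
    have xz: "x \<le> z" using le by simp
    note homs = hom[OF le(1)] hom[OF le(2)] hom[OF xz]
    show "FArr (pushforward C f A) (x, z)
      \<in> hom C (FObj (pushforward C f A) x) (FObj (pushforward C f A) z)" by (fact homs)
    show "FArr (pushforward C f A) (y, z) \<cdot> FArr (pushforward C f A) (x, y)
      \<in> hom C (FObj (pushforward C f A) x) (FObj (pushforward C f A) z)"
      using homs by (simp add: hom_def arr_simps)
    have "(FArr (pushforward C f A) (y, z) \<cdot> FArr (pushforward C f A) (x, y)) \<cdot> top_leg A x
        = FArr (pushforward C f A) (y, z) \<cdot> (top_leg A y \<cdot> FArr A (g x, g y))"
      using homs assms le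
      by (simp add: hom_def comp_assoc top_leg_arr pushforward_arr_top_leg)
    also have "\<dots> = (FArr (pushforward C f A) (y, z) \<cdot> top_leg A y) \<cdot> FArr A (g x, g y)"
      using homs assms le by (simp add: hom_def arr_simps top_leg_arr g_mono)
    also have "\<dots> = top_leg A z \<cdot> FArr A (g x, g z)"
      using assms le by (simp add: pushforward_arr_top_leg arr_simps top_leg_arr g_mono)
    finally show "(FArr (pushforward C f A) (y, z) \<cdot> FArr (pushforward C f A) (x, y)) \<cdot> top_leg A x
        = FArr (pushforward C f A) (x, z) \<cdot> top_leg A x"
      using assms xz by (simp add: pushforward_arr_top_leg)
  qed
qed

lemma pushforward_map_top_leg:
  assumes "is_module C A" "is_module C B" "module_map C A B \<phi>"
  shows "pushforward_map C f A B \<phi> q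
      \<in> hom C (FObj (pushforward C f A) q) (FObj (pushforward C f B) q)"
    and "pushforward_map C f A B \<phi> q \<cdot> top_leg A q = top_leg B q \<cdot> \<phi> (g q)"
proof -
  let ?K = "(fst (lan_colim C f B q), \<lambda>p. snd (lan_colim C f B q) p \<cdot> \<phi> p)"
  have \<phi>: "\<phi> p \<in> Arr C" "Dom C (\<phi> p) = FObj A p" "Cod C (\<phi> p) = FObj B p" for p
    using assms(3) by (auto simp: nat_trans_def poset_cat_def hom_def)
  have natural: "\<phi> p' \<cdot> FArr A (p, p') = FArr B (p, p') \<cdot> \<phi> p" if "p \<le> p'" for p p'
    using assms(3) that by (fastforce simp: nat_trans_def poset_cat_def)
  have leg: "snd (lan_colim C f B q) p \<in> Arr C"
    "Dom C (snd (lan_colim C f B q) p) = FObj B p"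
    "Cod C (snd (lan_colim C f B q) p) = fst (lan_colim C f B q)" if "p \<le> g q" for p
    using lan_leg[OF assms(2) that] by (auto simp: hom_def)
  have "(snd (lan_colim C f B q) p' \<cdot> \<phi> p') \<cdot> FArr A (p, p') = snd (lan_colim C f B q) p \<cdot> \<phi> p"
    if "p \<le> p'" "p \<le> g q" "p' \<le> g q" for p p'
  proof -
    have "(snd (lan_colim C f B q) p' \<cdot> \<phi> p') \<cdot> FArr A (p, p')
        = (snd (lan_colim C f B q) p' \<cdot> FArr B (p, p')) \<cdot> \<phi> p"
      using that assms(1,2) \<phi> leg by (simp add: arr_simps natural)
    then show ?thesis using that assms(2) by (simp add: lan_leg_comp)
  qed
  then have cocone: "is_cocone (slice f q) C A ?K"
    using \<phi> leg assms(2)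
    by (auto simp: slice_cocone_iff lan_obj hom_def arr_simps)
  show "pushforward_map C f A B \<phi> q
      \<in> hom C (FObj (pushforward C f A) q) (FObj (pushforward C f B) q)"
    using lan_desc(1)[OF assms(1) cocone] by (simp add: pushforward_map_def pushforward_def)
  show "pushforward_map C f A B \<phi> q \<cdot> top_leg A q = top_leg B q \<cdot> \<phi> (g q)"
    using lan_desc(2)[OF assms(1) cocone, of "g q"] by (simp add: pushforward_map_def top_leg_def)
qed

lemma lan_counit_top_leg:
  assumes "is_module C N"
  shows "lan_counit C f N q \<in> hom C (FObj (pushforward C f (pullback f N)) q) (FObj N q)"
    and "lan_counit C f N q \<cdot> top_leg (pullback f N) q = FArr N (f (g q), q)"
proof -
  have cocone: "is_cocone (slice f q) C (pullback f N) (FObj N q, \<lambda>p. FArr N (f p, q))"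
    using assms
    by (auto simp: is_cocone_def slice_def poset_cat_def pullback_def module_obj hom_def arr_simps
        f_mono)
  have pullback: "is_module C (pullback f N)"
    using assms f_mono by (intro pullback_module) (auto intro: monoI)
  show "lan_counit C f N q \<in> hom C (FObj (pushforward C f (pullback f N)) q) (FObj N q)"
    using lan_desc(1)[OF pullback cocone] by (simp add: lan_counit_def pushforward_def)
  show "lan_counit C f N q \<cdot> top_leg (pullback f N) q = FArr N (f (g q), q)"
    using lan_desc(2)[OF pullback cocone, of "g q"] by (simp add: lan_counit_def top_leg_def)
qed

lemma lan_unit_top_leg:
  "is_module C A \<Longrightarrow> lan_unit C f A p = top_leg A (f p) \<cdot> FArr A (p, g (f p))"
  by (simp add: lan_unit_def lan_leg_eq_top_leg unit_le)

lemma top_leg_inv_natural: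
  assumes "is_module C A" "q \<le> q'"
  shows "top_leg_inv A q' \<cdot> FArr (pushforward C f A) (q, q') = FArr A (g q, g q') \<cdot> top_leg_inv A q"
proof (rule lan_ext[OF assms(1)])
  let ?F = "FArr (pushforward C f A) (q, q')"
  note inv = top_leg_inv_hom[OF assms(1), of q] top_leg_inv_hom[OF assms(1), of q']
    pushforward_arr_hom(1)[OF assms]
  have le: "g q \<le> g q'" using g_mono[OF assms(2)] .
  show "top_leg_inv A q' \<cdot> ?F \<in> hom C (FObj (pushforward C f A) q) (FObj A (g q'))"
    using inv by (simp add: hom_def arr_simps)
  show "FArr A (g q, g q') \<cdot> top_leg_inv A q
      \<in> hom C (FObj (pushforward C f A) q) (FObj A (g q'))"
    using inv assms(1) le by (simp add: hom_def arr_simps)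
  have "(top_leg_inv A q' \<cdot> ?F) \<cdot> top_leg A q = (top_leg_inv A q' \<cdot> top_leg A q') \<cdot> FArr A (g q, g q')"
    using inv assms le by (simp add: hom_def arr_simps top_leg_arr pushforward_arr_top_leg)
  also have "\<dots> = FArr A (g q, g q') \<cdot> (top_leg_inv A q \<cdot> top_leg A q)"
    using assms(1) le by (simp add: top_leg_inv_left comp_Ide module_arr)
  also have "\<dots> = (FArr A (g q, g q') \<cdot> top_leg_inv A q) \<cdot> top_leg A q"
    using inv assms(1) le by (simp add: hom_def comp_assoc module_arr top_leg_arr)
  finally show "(top_leg_inv A q' \<cdot> ?F) \<cdot> top_leg A q
      = (FArr A (g q, g q') \<cdot> top_leg_inv A q) \<cdot> top_leg A q" .
qed

section \<open>Relative interleavings as interleavings along transported translations\<close>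

definition transport :: "(real \<Rightarrow> 'q \<Rightarrow> 'q) \<Rightarrow> real \<Rightarrow> 'p \<Rightarrow> 'p" where
  "transport T \<epsilon> p = g (T \<epsilon> (f p))"

lemma superlinear_family_transport:
  assumes "superlinear_family T"
  shows "superlinear_family (transport T)"
proof -
  note T = superlinear_familyD[OF assms]
  have "mono (transport T \<epsilon>)" if "0 \<le> \<epsilon>" for \<epsilon>
    using that by (intro monoI) (simp add: transport_def T(1) f_mono g_mono)
  moreover have "p \<le> transport T \<epsilon> p" if "0 \<le> \<epsilon>" for \<epsilon> p
    using T(2)[OF that, of "f p"] by (simp add: transport_def flip: adjoint)
  moreover have "transport T \<epsilon>\<^sub>2 (transport T \<epsilon>\<^sub>1 p) \<le> transport T (\<epsilon>\<^sub>1 + \<epsilon>\<^sub>2) p"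
    if "0 \<le> \<epsilon>\<^sub>1" "0 \<le> \<epsilon>\<^sub>2" for \<epsilon>\<^sub>1 \<epsilon>\<^sub>2 p
  proof -
    have "T \<epsilon>\<^sub>2 (f (g (T \<epsilon>\<^sub>1 (f p)))) \<le> T \<epsilon>\<^sub>2 (T \<epsilon>\<^sub>1 (f p))"
      using that by (intro T(1) counit_le)
    also have "\<dots> \<le> T (\<epsilon>\<^sub>1 + \<epsilon>\<^sub>2) (f p)"
      using that by (intro T(3))
    finally show ?thesis by (simp add: transport_def g_mono)
  qed
  ultimately show ?thesis
    by (simp add: superlinear_family_def translation_def)
qed

text \<open>
  The isomorphism \<open>B \<circ> g \<cong> f\<^sub>*B\<close>, read at \<open>T \<epsilon> (f p)\<close>, turns maps into \<open>B \<circ> transport T \<epsilon>\<close> into maps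
  into the relative shift of \<open>B\<close>, and back.
\<close>

definition to_relative where
  "to_relative T \<epsilon> B \<phi> p = top_leg B (T \<epsilon> (f p)) \<cdot> \<phi> p"

definition from_relative where
  "from_relative T \<epsilon> B \<phi> p = top_leg_inv B (T \<epsilon> (f p)) \<cdot> \<phi> p"

lemma relative_map_arr:
  assumes "module_map C A (shiftP C f T \<epsilon> B) \<phi>"
  shows "\<phi> p \<in> Arr C" "Dom C (\<phi> p) = FObj A p"
    "Cod C (\<phi> p) = FObj (pushforward C f B) (T \<epsilon> (f p))"
  using assms by (auto simp: nat_trans_def poset_cat_def hom_def shiftP_def shiftQ_def pullback_def)

lemma to_relative_map:
  assumes T: "superlinear_family T" "0 \<le> \<epsilon>" and AB: "is_module C A" "is_module C B"
    and \<phi>: "module_map C A (shiftQ (transport T) \<epsilon> B) \<phi>"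
  shows "module_map C A (shiftP C f T \<epsilon> B) (to_relative T \<epsilon> B \<phi>)"
proof -
  let ?F = "FArr (pushforward C f B)"
  note arrs = AB top_leg_arr shifted_map_arr[OF \<phi>]
  have "to_relative T \<epsilon> B \<phi> p \<in> hom C (FObj A p) (FObj (pushforward C f B) (T \<epsilon> (f p)))" for p
    using arrs by (simp add: to_relative_def hom_def arr_simps transport_def)
  moreover have "to_relative T \<epsilon> B \<phi> p' \<cdot> FArr A (p, p')
      = ?F (T \<epsilon> (f p), T \<epsilon> (f p')) \<cdot> to_relative T \<epsilon> B \<phi> p" if "p \<le> p'" for p p'
  proof -
    let ?q = "T \<epsilon> (f p)" and ?q' = "T \<epsilon> (f p')"
    have q: "?q \<le> ?q'" by (rule superlinear_familyD(1)[OF T f_mono[OF that]])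
    note F = pushforward_arr_hom(1)[OF AB(2) q, unfolded hom_def]
    have "to_relative T \<epsilon> B \<phi> p' \<cdot> FArr A (p, p') = top_leg B ?q' \<cdot> (\<phi> p' \<cdot> FArr A (p, p'))"
      using arrs that by (simp add: to_relative_def comp_assoc module_arr transport_def)
    also have "\<dots> = (top_leg B ?q' \<cdot> FArr B (g ?q, g ?q')) \<cdot> \<phi> p"
      using arrs g_mono[OF q]
      by (simp add: shifted_map_natural[OF \<phi> that] comp_assoc module_arr transport_def)
    also have "\<dots> = ?F (?q, ?q') \<cdot> to_relative T \<epsilon> B \<phi> p"
      using arrs F
      by (simp add: to_relative_def comp_assoc transport_def
          flip: pushforward_arr_top_leg[OF AB(2) q])
    finally show ?thesis .
  qed
  ultimately show ?thesis
    by (auto simp: nat_trans_def poset_cat_def shiftP_def shiftQ_def pullback_def)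
qed

lemma from_relative_map:
  assumes T: "superlinear_family T" "0 \<le> \<epsilon>" and AB: "is_module C A" "is_module C B"
    and \<phi>: "module_map C A (shiftP C f T \<epsilon> B) \<phi>"
  shows "module_map C A (shiftQ (transport T) \<epsilon> B) (from_relative T \<epsilon> B \<phi>)"
proof (rule shifted_mapI)
  let ?F = "FArr (pushforward C f B)"
  note arrs = AB relative_map_arr[OF \<phi>] top_leg_inv_hom[OF AB(2), unfolded hom_def]
  show "from_relative T \<epsilon> B \<phi> p \<in> hom C (FObj A p) (FObj B (transport T \<epsilon> p))" for p
    using arrs by (simp add: from_relative_def hom_def arr_simps transport_def)
  show "from_relative T \<epsilon> B \<phi> p' \<cdot> FArr A (p, p')
      = FArr B (transport T \<epsilon> p, transport T \<epsilon> p') \<cdot> from_relative T \<epsilon> B \<phi> p" if "p \<le> p'" for p p'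
  proof -
    let ?q = "T \<epsilon> (f p)" and ?q' = "T \<epsilon> (f p')"
    have q: "?q \<le> ?q'" by (rule superlinear_familyD(1)[OF T f_mono[OF that]])
    note F = pushforward_arr_hom(1)[OF AB(2) q, unfolded hom_def]
    have natural: "\<phi> p' \<cdot> FArr A (p, p') = ?F (?q, ?q') \<cdot> \<phi> p"
      using \<phi> that
      by (fastforce simp: nat_trans_def poset_cat_def shiftP_def shiftQ_def pullback_def)
    have "from_relative T \<epsilon> B \<phi> p' \<cdot> FArr A (p, p') = top_leg_inv B ?q' \<cdot> (\<phi> p' \<cdot> FArr A (p, p'))"
      using arrs that by (simp add: from_relative_def comp_assoc module_arr)
    also have "\<dots> = (top_leg_inv B ?q' \<cdot> ?F (?q, ?q')) \<cdot> \<phi> p"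
      using arrs F by (simp add: natural comp_assoc)
    also have "\<dots> = FArr B (g ?q, g ?q') \<cdot> from_relative T \<epsilon> B \<phi> p"
      using arrs g_mono[OF q]
      by (simp add: top_leg_inv_natural[OF AB(2) q] from_relative_def comp_assoc module_arr)
    finally show ?thesis by (simp add: transport_def)
  qed
qed

lemma to_from_relative:
  assumes "is_module C B" "module_map C A (shiftP C f T \<epsilon> B) \<phi>"
  shows "to_relative T \<epsilon> B (from_relative T \<epsilon> B \<phi>) = \<phi>"
proof
  fix p
  note arrs = assms(1) top_leg_arr relative_map_arr[OF assms(2)]
    top_leg_inv_hom[OF assms(1), unfolded hom_def]
  have "to_relative T \<epsilon> B (from_relative T \<epsilon> B \<phi>) p
      = (top_leg B (T \<epsilon> (f p)) \<cdot> top_leg_inv B (T \<epsilon> (f p))) \<cdot> \<phi> p"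
    using arrs by (simp add: to_relative_def from_relative_def comp_assoc)
  also have "\<dots> = \<phi> p"
    using arrs by (simp add: top_leg_inv_right comp_Ide)
  finally show "to_relative T \<epsilon> B (from_relative T \<epsilon> B \<phi>) p = \<phi> p" .
qed

lemma top_leg_mono:
  assumes "is_module C A" "u \<in> hom C z (FObj A (g q))" "v \<in> hom C z (FObj A (g q))"
    and "top_leg A q \<cdot> u = top_leg A q \<cdot> v"
  shows "u = v"
proof -
  have "w = top_leg_inv A q \<cdot> (top_leg A q \<cdot> w)" if "w \<in> hom C z (FObj A (g q))" for w
    using that assms(1) top_leg_inv_hom[OF assms(1), of q] top_leg_arr[OF assms(1), of q]
      comp_assoc[of w "top_leg A q" "top_leg_inv A q"]
    by (simp add: hom_def top_leg_inv_left comp_Ide)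
  then show ?thesis using assms by metis
qed

text \<open>
  The two sides of the relative interleaving equation, here and in \<open>relative_round_trip\<close>, are those
  of the equation for \<open>transport T\<close>, followed by one and the same isomorphism \<open>top_leg\<close>. Cancelling it
  with \<open>top_leg_mono\<close> shows that the equations are equivalent.
\<close>

lemma relative_eta:
  assumes T: "superlinear_family T" "0 \<le> \<epsilon>" and A: "is_module C A"
  shows "vcomp C (etaP2 C f T 0 \<epsilon> A) (etaP C f T 0 A) p
    = top_leg A (T \<epsilon> (f p)) \<cdot> FArr A (p, transport T \<epsilon> p)"
proof -
  let ?F = "FArr (pushforward C f A)"
  have le: "f p \<le> T 0 (f p)" "T 0 (f p) \<le> T \<epsilon> (f p)"
    using superlinear_familyD(2)[OF T(1)] superlinear_family_index_mono[OF T(1)] T(2) by auto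
  have f\<epsilon>: "f p \<le> T \<epsilon> (f p)" using le by (rule order_trans)
  note F = pushforward_module[OF A]
  have "vcomp C (etaP2 C f T 0 \<epsilon> A) (etaP C f T 0 A) p
      = ?F (T 0 (f p), T \<epsilon> (f p)) \<cdot> (?F (f p, T 0 (f p)) \<cdot> (top_leg A (f p) \<cdot> FArr A (p, g (f p))))"
    by (simp add: vcomp_def etaP2_def etaP_def etaQ2_def etaQ_def lan_unit_top_leg[OF A])
  also have "\<dots> = (?F (f p, T \<epsilon> (f p)) \<cdot> top_leg A (f p)) \<cdot> FArr A (p, g (f p))"
    using A F le f\<epsilon> unit_le[of p]
    by (simp add: comp_in_Arr comp_Cod comp_assoc module_comp_left module_arr top_leg_arr)
  also have "\<dots> = top_leg A (T \<epsilon> (f p)) \<cdot> (FArr A (g (f p), g (T \<epsilon> (f p))) \<cdot> FArr A (p, g (f p)))"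
    using A unit_le[of p] g_mono[OF f\<epsilon>]
    by (simp add: pushforward_arr_top_leg[OF A f\<epsilon>] comp_assoc module_arr top_leg_arr)
  also have "\<dots> = top_leg A (T \<epsilon> (f p)) \<cdot> FArr A (p, transport T \<epsilon> p)"
    using A unit_le[of p] g_mono[OF f\<epsilon>] by (simp add: module_comp transport_def)
  finally show ?thesis .
qed

lemma relative_round_trip:
  assumes T: "superlinear_family T" "0 \<le> \<epsilon>" and AB: "is_module C A" "is_module C B"
    and \<phi>: "module_map C A (shiftQ (transport T) \<epsilon> B) \<phi>"
    and \<psi>: "module_map C B (shiftQ (transport T) \<epsilon> A) \<psi>"
  shows "vcomp C (SigmaP C f T \<epsilon> \<epsilon> A)
      (vcomp C (shiftP_map C f T \<epsilon> B (shiftP C f T \<epsilon> A) (to_relative T \<epsilon> A \<psi>))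
        (to_relative T \<epsilon> B \<phi>)) p
    = top_leg A (T (2 * \<epsilon>) (f p)) \<cdot>
      (FArr A (transport T \<epsilon> (transport T \<epsilon> p), transport T (2 * \<epsilon>) p)
        \<cdot> (\<psi> (transport T \<epsilon> p) \<cdot> \<phi> p))"
proof -
  let ?q = "T \<epsilon> (f p)" and ?r = "T (2 * \<epsilon>) (f p)"
  let ?s = "T \<epsilon> (f (g ?q))"
  let ?G = "pushforward C f A"
  let ?G' = "shiftQ T \<epsilon> ?G"
  let ?A' = "shiftP C f T \<epsilon> A"
  let ?p = "pushforward_map C f B ?A' (to_relative T \<epsilon> A \<psi>) ?q"
  let ?c = "lan_counit C f ?G' ?q"
  have le: "?s \<le> T \<epsilon> ?q" "T \<epsilon> ?q \<le> ?r"
    using superlinear_familyD(1)[OF T counit_le] superlinear_family_twice[OF T] by auto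
  have sr: "?s \<le> ?r" using le by (rule order_trans)
  have G: "is_module C ?G" using pushforward_module[OF AB(1)] .
  have G': "is_module C ?G'"
    unfolding shiftQ_def
    by (intro pullback_module[OF G] monoI superlinear_familyD(1)[OF T])
  have A'_eq: "?A' = pullback f ?G'" by (simp add: shiftP_def)
  have A': "is_module C ?A'"
    unfolding A'_eq
    by (intro pullback_module[OF G'] monoI f_mono)
  note \<psi>' = to_relative_map[OF T AB(2,1) \<psi>]
  note arrs = shifted_map_arr[OF \<phi>] shifted_map_arr[OF \<psi>] relative_map_arr[OF \<psi>']
  note push = pushforward_map_top_leg[OF AB(2) A' \<psi>', of ?q]
  note counit = lan_counit_top_leg[OF G', of ?q, folded A'_eq]
  have A'_obj: "FObj ?A' p = FObj ?G (T \<epsilon> (f p))" for p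
    by (simp add: shiftP_def shiftQ_def pullback_def)
  have G'_obj: "FObj ?G' q = FObj ?G (T \<epsilon> q)" for q
    by (simp add: shiftQ_def pullback_def)
  note homs = push(1) counit(1)
  have "vcomp C (SigmaP C f T \<epsilon> \<epsilon> A)
      (vcomp C (shiftP_map C f T \<epsilon> B ?A' (to_relative T \<epsilon> A \<psi>)) (to_relative T \<epsilon> B \<phi>)) p
    = (FArr ?G (T \<epsilon> ?q, ?r) \<cdot> ?c) \<cdot> (?p \<cdot> (top_leg B ?q \<cdot> \<phi> p))"
    by (simp add: vcomp_def SigmaP_def SigmaQ_def shiftP_map_def to_relative_def flip: mult_2)
  also have "\<dots> = FArr ?G (T \<epsilon> ?q, ?r) \<cdot> (?c \<cdot> ((?p \<cdot> top_leg B ?q) \<cdot> \<phi> p))"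
    using homs arrs AB le G G'_obj
    by (simp add: hom_def arrow_rules comp_assoc top_leg_arr
        transport_def)
  \<comment> \<open>A map induced on a colimit is evaluated on a top leg: first the pushforward of \<open>\<psi>\<close>, then the
    counit, and finally the internal map of \<open>f\<^sub>*A\<close>.\<close>
  also have "\<dots> = FArr ?G (T \<epsilon> ?q, ?r) \<cdot> (?c \<cdot> ((top_leg ?A' ?q \<cdot> to_relative T \<epsilon> A \<psi> (g ?q)) \<cdot> \<phi> p))"
    by (simp add: push(2))
  also have "\<dots> = FArr ?G (T \<epsilon> ?q, ?r) \<cdot> ((?c \<cdot> top_leg ?A' ?q) \<cdot> (to_relative T \<epsilon> A \<psi> (g ?q) \<cdot> \<phi> p))"
    using homs arrs A' A'_obj
    by (simp add: hom_def comp_in_Arr comp_Dom comp_Cod comp_assoc top_leg_arr transport_def)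
  also have "\<dots> = FArr ?G (T \<epsilon> ?q, ?r) \<cdot> (FArr ?G (?s, T \<epsilon> ?q) \<cdot> (to_relative T \<epsilon> A \<psi> (g ?q) \<cdot> \<phi> p))"
    using counit(2) by (simp add: shiftQ_def pullback_def)
  also have "\<dots> = FArr ?G (?s, ?r) \<cdot> (top_leg A ?s \<cdot> (\<psi> (g ?q) \<cdot> \<phi> p))"
    using arrs G AB le
    by (simp add: to_relative_def comp_in_Arr comp_Dom comp_Cod comp_assoc module_comp_left
        top_leg_arr transport_def)
  also have "\<dots> = (FArr ?G (?s, ?r) \<cdot> top_leg A ?s) \<cdot> (\<psi> (g ?q) \<cdot> \<phi> p)"
    using arrs G AB sr
    by (simp add: arrow_rules comp_assoc top_leg_arr transport_def)
  also have "\<dots> = (top_leg A ?r \<cdot> FArr A (g ?s, g ?r)) \<cdot> (\<psi> (g ?q) \<cdot> \<phi> p)"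
    by (simp add: pushforward_arr_top_leg[OF AB(1) sr])
  also have "\<dots> = top_leg A ?r \<cdot> (FArr A (g ?s, g ?r) \<cdot> (\<psi> (g ?q) \<cdot> \<phi> p))"
    using arrs AB g_mono[OF sr]
    by (simp add: arrow_rules comp_assoc top_leg_arr transport_def)
  finally show ?thesis by (simp add: transport_def)
qed

lemma relative_round_trip_iff:
  assumes T: "superlinear_family T" "0 \<le> \<epsilon>" and AB: "is_module C A" "is_module C B"
    and \<phi>: "module_map C A (shiftQ (transport T) \<epsilon> B) \<phi>"
    and \<psi>: "module_map C B (shiftQ (transport T) \<epsilon> A) \<psi>"
  shows "vcomp C (SigmaP C f T \<epsilon> \<epsilon> A)
      (vcomp C (shiftP_map C f T \<epsilon> B (shiftP C f T \<epsilon> A) (to_relative T \<epsilon> A \<psi>))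
        (to_relative T \<epsilon> B \<phi>))
      = vcomp C (etaP2 C f T 0 (2 * \<epsilon>) A) (etaP C f T 0 A)
    \<longleftrightarrow> round_trip (transport T) \<epsilon> A \<phi> \<psi>"
proof -
  let ?S = "transport T"
  have S: "superlinear_family ?S" using superlinear_family_transport[OF T(1)] .
  have "top_leg A (T (2 * \<epsilon>) (f p)) \<cdot> (FArr A (?S \<epsilon> (?S \<epsilon> p), ?S (2 * \<epsilon>) p) \<cdot> (\<psi> (?S \<epsilon> p) \<cdot> \<phi> p))
        = top_leg A (T (2 * \<epsilon>) (f p)) \<cdot> FArr A (p, ?S (2 * \<epsilon>) p)
      \<longleftrightarrow> FArr A (?S \<epsilon> (?S \<epsilon> p), ?S (2 * \<epsilon>) p) \<cdot> (\<psi> (?S \<epsilon> p) \<cdot> \<phi> p) = FArr A (p, ?S (2 * \<epsilon>) p)" for p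
  proof -
    have le: "?S \<epsilon> (?S \<epsilon> p) \<le> ?S (2 * \<epsilon>) p" "p \<le> ?S (2 * \<epsilon>) p"
      using superlinear_family_twice[OF S T(2)] superlinear_familyD(2)[OF S, of "2 * \<epsilon>"] T(2)
      by auto
    have homs: "FArr A (?S \<epsilon> (?S \<epsilon> p), ?S (2 * \<epsilon>) p) \<cdot> (\<psi> (?S \<epsilon> p) \<cdot> \<phi> p)
        \<in> hom C (FObj A p) (FObj A (g (T (2 * \<epsilon>) (f p))))"
      "FArr A (p, ?S (2 * \<epsilon>) p) \<in> hom C (FObj A p) (FObj A (g (T (2 * \<epsilon>) (f p))))"
      using le AB shifted_map_arr[OF \<phi>] shifted_map_arr[OF \<psi>]
      by (simp_all add: hom_def comp_in_Arr comp_Dom comp_Cod module_arr)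
        (simp_all add: transport_def)
    show ?thesis using top_leg_mono[OF AB(1) homs] by auto
  qed
  then show ?thesis
    using T(2)
    by (simp add: fun_eq_iff relative_round_trip[OF assms] relative_eta[OF T(1) _ AB(1)] round_trip_def)
qed

text \<open>
  Every relative map arises from a map along \<open>transport T\<close> because \<open>top_leg\<close> is invertible, so the
  equivalence of the interleaving equations carries interleavings over in both directions.
\<close>

lemma weak_interleavingP_iff_transport:
  assumes T: "superlinear_family T" "0 \<le> \<epsilon>" and AB: "is_module C A" "is_module C B"
  shows "(\<exists>\<phi> \<psi>. weak_interleavingP C f T \<epsilon> A B \<phi> \<psi>)
    \<longleftrightarrow> (\<exists>\<phi> \<psi>. weak_interleavingQ C (transport T) \<epsilon> A B \<phi> \<psi>)"
proof
  assume "\<exists>\<phi> \<psi>. weak_interleavingP C f T \<epsilon> A B \<phi> \<psi>"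
  then obtain \<phi> \<psi> where P: "weak_interleavingP C f T \<epsilon> A B \<phi> \<psi>" by blast
  let ?\<phi> = "from_relative T \<epsilon> B \<phi>" and ?\<psi> = "from_relative T \<epsilon> A \<psi>"
  have maps: "module_map C A (shiftP C f T \<epsilon> B) \<phi>" "module_map C B (shiftP C f T \<epsilon> A) \<psi>"
    using P by (auto simp: weak_interleavingP_def)
  note \<phi> = from_relative_map[OF T AB maps(1)] and \<psi> = from_relative_map[OF T AB(2,1) maps(2)]
  have "round_trip (transport T) \<epsilon> A ?\<phi> ?\<psi>" "round_trip (transport T) \<epsilon> B ?\<psi> ?\<phi>"
    using relative_round_trip_iff[OF T AB \<phi> \<psi>] relative_round_trip_iff[OF T AB(2,1) \<psi> \<phi>]
      to_from_relative[OF AB(2) maps(1)] to_from_relative[OF AB(1) maps(2)] P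
    unfolding weak_interleavingP_def by simp_all
  then show "\<exists>\<phi> \<psi>. weak_interleavingQ C (transport T) \<epsilon> A B \<phi> \<psi>"
    using weak_interleavingQ_iff_round_trip[OF superlinear_family_transport[OF T(1)] T(2) AB] \<phi> \<psi>
    by blast
next
  assume "\<exists>\<phi> \<psi>. weak_interleavingQ C (transport T) \<epsilon> A B \<phi> \<psi>"
  then obtain \<phi> \<psi> where
    \<phi>: "module_map C A (shiftQ (transport T) \<epsilon> B) \<phi>" and
    \<psi>: "module_map C B (shiftQ (transport T) \<epsilon> A) \<psi>" and
    trips: "round_trip (transport T) \<epsilon> A \<phi> \<psi>" "round_trip (transport T) \<epsilon> B \<psi> \<phi>"
    using weak_interleavingQ_iff_round_trip[OF superlinear_family_transport[OF T(1)] T(2) AB]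
    by blast
  have "weak_interleavingP C f T \<epsilon> A B (to_relative T \<epsilon> B \<phi>) (to_relative T \<epsilon> A \<psi>)"
    unfolding weak_interleavingP_def
    using to_relative_map[OF T AB \<phi>] to_relative_map[OF T AB(2,1) \<psi>] trips
      relative_round_trip_iff[OF T AB \<phi> \<psi>] relative_round_trip_iff[OF T AB(2,1) \<psi> \<phi>]
    by blast
  then show "\<exists>\<phi> \<psi>. weak_interleavingP C f T \<epsilon> A B \<phi> \<psi>" by blast
qed

section \<open>Comparing interleavings over the two posets\<close>

context
  fixes T :: "real \<Rightarrow> 'q \<Rightarrow> 'q" and \<delta> :: real
  assumes T: "superlinear_family T" and \<delta>: "0 \<le> \<delta>"
    and approx: "q \<le> f (g (T \<delta> q))"
begin

text \<open>
  The slack \<open>\<delta>\<close> pays for rounding down to the image of \<open>f\<close>.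
\<close>

lemma le_rounded_shift:
  assumes "0 \<le> \<alpha>" "\<alpha> + \<delta> \<le> \<beta>"
  shows "T \<alpha> x \<le> f (g (T \<beta> x))"
proof -
  have "T \<delta> (T \<alpha> x) \<le> T (\<alpha> + \<delta>) x"
    using superlinear_familyD(3)[OF T] assms(1) \<delta> by blast
  also have "\<dots> \<le> T \<beta> x"
    using superlinear_family_index_mono[OF T] assms \<delta> by simp
  finally have "f (g (T \<delta> (T \<alpha> x))) \<le> f (g (T \<beta> x))"
    by (intro f_mono g_mono)
  then show ?thesis using approx order_trans by blast
qed

definition restrict_map :: "real \<Rightarrow> ('q, 'o, 'a) pmod \<Rightarrow> ('q \<Rightarrow> 'a) \<Rightarrow> 'p \<Rightarrow> 'a" where
  "restrict_map \<epsilon> N \<phi> p = FArr N (T \<epsilon> (f p), f (g (T (\<epsilon> + \<delta>) (f p)))) \<cdot> \<phi> (f p)"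

lemma restrict_map_natural:
  assumes MN: "is_module C M" "is_module C N" and \<epsilon>: "0 \<le> \<epsilon>"
    and \<phi>: "module_map C M (shiftQ T \<epsilon> N) \<phi>"
  shows "module_map C (pullback f M) (shiftQ (transport T) (\<epsilon> + \<delta>) (pullback f N))
    (restrict_map \<epsilon> N \<phi>)"
proof (rule shifted_mapI)
  note arrs = MN shifted_map_arr[OF \<phi>]
  have round: "T \<epsilon> x \<le> f (g (T (\<epsilon> + \<delta>) x))" for x
    using \<epsilon> by (intro le_rounded_shift) auto
  show "restrict_map \<epsilon> N \<phi> p \<in> hom C (FObj (pullback f M) p)
      (FObj (pullback f N) (transport T (\<epsilon> + \<delta>) p))" for p
    using arrs round by (simp add: arrow_rules restrict_map_def pullback_def transport_def hom_def)
  show "restrict_map \<epsilon> N \<phi> p' \<cdot> FArr (pullback f M) (p, p')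
      = FArr (pullback f N) (transport T (\<epsilon> + \<delta>) p, transport T (\<epsilon> + \<delta>) p') \<cdot> restrict_map \<epsilon> N \<phi> p"
    if "p \<le> p'" for p p'
  proof -
    let ?h = "\<lambda>p. f (g (T (\<epsilon> + \<delta>) (f p)))"
    have le: "f p \<le> f p'" using f_mono[OF that] .
    have le_T: "T \<epsilon> (f p) \<le> T \<epsilon> (f p')" using superlinear_familyD(1)[OF T \<epsilon> le] .
    have le_h: "?h p \<le> ?h p'"
      using superlinear_familyD(1)[OF T _ le, of "\<epsilon> + \<delta>"] \<epsilon> \<delta> by (simp add: f_mono g_mono)
    have "restrict_map \<epsilon> N \<phi> p' \<cdot> FArr (pullback f M) (p, p')
        = FArr N (T \<epsilon> (f p'), ?h p') \<cdot> (\<phi> (f p') \<cdot> FArr M (f p, f p'))"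
      using arrs round le by (simp add: arrow_rules restrict_map_def pullback_def comp_assoc)
    also have "\<dots> = FArr N (T \<epsilon> (f p), ?h p') \<cdot> \<phi> (f p)"
      using arrs round[of "f p'"] le_T by (simp add: arrow_rules shifted_map_natural[OF \<phi> le] module_comp_left)
    also have "\<dots> = FArr N (?h p, ?h p') \<cdot> restrict_map \<epsilon> N \<phi> p"
      using arrs round[of "f p"] le_h by (simp add: arrow_rules restrict_map_def module_comp_left)
    finally show ?thesis by (simp add: pullback_def transport_def)
  qed
qed

text \<open>
  Naturality of \<open>\<psi>\<close> moves the rounding map of \<open>N\<close> behind \<open>\<psi>\<close>, so that \<open>\<psi>\<close> directly follows \<open>\<phi>\<close>. The
  composite \<open>\<psi> \<phi>\<close> is known only after the internal map to \<open>T (2 * \<epsilon>) (f p)\<close>, so the remaining internal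
  map must factor through that point. It does: \<open>T (2 * \<epsilon>) (f p)\<close> lies below the target, as
  \<open>2 * \<epsilon> + \<delta> \<le> 2 * (\<epsilon> + \<delta>)\<close>.
\<close>

lemma restrict_round_trip:
  assumes MN: "is_module C M" "is_module C N" and \<epsilon>: "0 \<le> \<epsilon>"
    and \<phi>: "module_map C M (shiftQ T \<epsilon> N) \<phi>" and \<psi>: "module_map C N (shiftQ T \<epsilon> M) \<psi>"
    and trip: "round_trip T \<epsilon> M \<phi> \<psi>"
  shows "round_trip (transport T) (\<epsilon> + \<delta>) (pullback f M) (restrict_map \<epsilon> N \<phi>) (restrict_map \<epsilon> M \<psi>)"
  unfolding round_trip_def
proof
  fix p
  let ?\<epsilon>' = "\<epsilon> + \<delta>" and ?S = "transport T" and ?x = "f p"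
  let ?a = "T \<epsilon> ?x" and ?b = "f (?S ?\<epsilon>' p)"
  let ?c = "f (?S ?\<epsilon>' (?S ?\<epsilon>' p))" and ?d = "f (?S (2 * ?\<epsilon>') p)"
  have S: "superlinear_family ?S" using superlinear_family_transport[OF T] .
  have \<epsilon>': "0 \<le> ?\<epsilon>'" using \<epsilon> \<delta> by simp
  have ab: "?a \<le> ?b"
    using \<epsilon> le_rounded_shift[of \<epsilon> ?\<epsilon>' ?x] by (simp add: transport_def)
  have TaTb: "T \<epsilon> ?a \<le> T \<epsilon> ?b" using superlinear_familyD(1)[OF T \<epsilon> ab] .
  have Tbc: "T \<epsilon> ?b \<le> ?c"
    using \<epsilon> le_rounded_shift[of \<epsilon> ?\<epsilon>' ?b] by (simp add: transport_def)
  have cd: "?c \<le> ?d" using f_mono[OF superlinear_family_twice[OF S \<epsilon>']] .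
  have Ta: "T \<epsilon> ?a \<le> T (2 * \<epsilon>) ?x" using superlinear_family_twice[OF T \<epsilon>] .
  have xT: "?x \<le> T (2 * \<epsilon>) ?x" using superlinear_familyD(2)[OF T] \<epsilon> by simp
  have Td: "T (2 * \<epsilon>) ?x \<le> ?d"
    using \<epsilon> \<delta> le_rounded_shift[of "2 * \<epsilon>" "2 * ?\<epsilon>'" ?x] by (simp add: transport_def)
  note le = ab TaTb Tbc cd Ta Td xT order_trans[OF TaTb Tbc] order_trans[OF Ta Td] order_trans[OF Tbc cd]
  note arrs = MN le shifted_map_arr[OF \<phi>] shifted_map_arr[OF \<psi>]
  have "FArr M (?c, ?d) \<cdot> (restrict_map \<epsilon> M \<psi> (?S ?\<epsilon>' p) \<cdot> restrict_map \<epsilon> N \<phi> p)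
      = FArr M (?c, ?d) \<cdot> ((FArr M (T \<epsilon> ?b, ?c) \<cdot> \<psi> ?b) \<cdot> (FArr N (?a, ?b) \<cdot> \<phi> ?x))"
    by (simp add: restrict_map_def transport_def)
  also have "\<dots> = FArr M (T \<epsilon> ?b, ?d) \<cdot> ((\<psi> ?b \<cdot> FArr N (?a, ?b)) \<cdot> \<phi> ?x)"
    using arrs by (simp add: arrow_rules comp_assoc module_comp_left)
  also have "\<dots> = FArr M (T \<epsilon> ?a, ?d) \<cdot> (\<psi> ?a \<cdot> \<phi> ?x)"
    using arrs by (simp add: arrow_rules shifted_map_natural[OF \<psi> ab] comp_assoc module_comp_left)
  also have "\<dots> = FArr M (T (2 * \<epsilon>) ?x, ?d) \<cdot> (FArr M (T \<epsilon> ?a, T (2 * \<epsilon>) ?x) \<cdot> (\<psi> ?a \<cdot> \<phi> ?x))"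
    using arrs by (simp add: arrow_rules module_comp_left)
  also have "\<dots> = FArr M (T (2 * \<epsilon>) ?x, ?d) \<cdot> FArr M (?x, T (2 * \<epsilon>) ?x)"
    using trip by (simp add: round_trip_def)
  also have "\<dots> = FArr M (?x, ?d)"
    using MN le by (simp add: module_comp)
  finally show "FArr (pullback f M) (?S ?\<epsilon>' (?S ?\<epsilon>' p), ?S (2 * ?\<epsilon>') p) \<cdot>
      (restrict_map \<epsilon> M \<psi> (?S ?\<epsilon>' p) \<cdot> restrict_map \<epsilon> N \<phi> p) = FArr (pullback f M) (p, ?S (2 * ?\<epsilon>') p)"
    by (simp add: pullback_def)
qed

text \<open>
  The map \<open>\<phi>\<close> exists only over the image of \<open>f\<close>, so it is used at \<open>g (T \<delta> q)\<close>, whose image lies above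
  \<open>q\<close>; the internal maps of \<open>M\<close> and \<open>N\<close> lead there and back.
\<close>

definition extend_map ::
  "real \<Rightarrow> ('q, 'o, 'a) pmod \<Rightarrow> ('q, 'o, 'a) pmod \<Rightarrow> ('p \<Rightarrow> 'a) \<Rightarrow> 'q \<Rightarrow> 'a" where
  "extend_map \<epsilon> M N \<phi> q =
     FArr N (f (transport T \<epsilon> (g (T \<delta> q))), T (\<epsilon> + \<delta>) q) \<cdot>
       (\<phi> (g (T \<delta> q)) \<cdot> FArr M (q, f (g (T \<delta> q))))"

lemma transport_approx_le:
  assumes "0 \<le> \<epsilon>"
  shows "T \<epsilon> (f (g (T \<delta> q))) \<le> T (\<epsilon> + \<delta>) q"
proof -
  have "T \<epsilon> (f (g (T \<delta> q))) \<le> T \<epsilon> (T \<delta> q)"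
    using superlinear_familyD(1)[OF T assms counit_le] .
  also have "\<dots> \<le> T (\<epsilon> + \<delta>) q"
    using superlinear_familyD(3)[OF T \<delta> assms] by (simp add: add.commute)
  finally show ?thesis .
qed

lemma transport_approx_le':
  assumes "0 \<le> \<epsilon>"
  shows "f (transport T \<epsilon> (g (T \<delta> q))) \<le> T (\<epsilon> + \<delta>) q"
  using order_trans[OF counit_le transport_approx_le[OF assms]] by (simp add: transport_def)

lemma pulled_back_map_arr:
  assumes "module_map C (pullback f M) (shiftQ (transport T) \<epsilon> (pullback f N)) \<phi>"
  shows "\<phi> p \<in> Arr C" "Dom C (\<phi> p) = FObj M (f p)" "Cod C (\<phi> p) = FObj N (f (transport T \<epsilon> p))"
  using shifted_map_arr[OF assms] by (simp_all add: pullback_def)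

lemma pulled_back_map_natural:
  assumes "module_map C (pullback f M) (shiftQ (transport T) \<epsilon> (pullback f N)) \<phi>" "p \<le> p'"
  shows "\<phi> p' \<cdot> FArr M (f p, f p')
    = FArr N (f (transport T \<epsilon> p), f (transport T \<epsilon> p')) \<cdot> \<phi> p"
  using shifted_map_natural[OF assms] by (simp add: pullback_def)

lemma extend_map_natural:
  assumes MN: "is_module C M" "is_module C N" and \<epsilon>: "0 \<le> \<epsilon>"
    and \<phi>: "module_map C (pullback f M) (shiftQ (transport T) \<epsilon> (pullback f N)) \<phi>"
  shows "module_map C M (shiftQ T (\<epsilon> + \<delta>) N) (extend_map \<epsilon> M N \<phi>)"
proof (rule shifted_mapI)
  note arrs = MN pulled_back_map_arr[OF \<phi>] approx
    transport_approx_le'[OF \<epsilon>]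
  show "extend_map \<epsilon> M N \<phi> q \<in> hom C (FObj M q) (FObj N (T (\<epsilon> + \<delta>) q))" for q
    using arrs by (simp add: arrow_rules extend_map_def hom_def)
  show "extend_map \<epsilon> M N \<phi> q' \<cdot> FArr M (q, q')
      = FArr N (T (\<epsilon> + \<delta>) q, T (\<epsilon> + \<delta>) q') \<cdot> extend_map \<epsilon> M N \<phi> q" if q: "q \<le> q'" for q q'
  proof -
    let ?z = "g (T \<delta> q)" and ?z' = "g (T \<delta> q')"
    let ?w = "f (transport T \<epsilon> ?z)" and ?w' = "f (transport T \<epsilon> ?z')"
    have z: "?z \<le> ?z'" using g_mono[OF superlinear_familyD(1)[OF T \<delta> q]] .
    have w: "?w \<le> ?w'"
      using f_mono[OF superlinear_familyD(1)[OF superlinear_family_transport[OF T] \<epsilon> z]] .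
    have t: "T (\<epsilon> + \<delta>) q \<le> T (\<epsilon> + \<delta>) q'"
      using superlinear_familyD(1)[OF T _ q] \<epsilon> \<delta> by simp
    have "extend_map \<epsilon> M N \<phi> q' \<cdot> FArr M (q, q')
        = FArr N (?w', T (\<epsilon> + \<delta>) q') \<cdot> (\<phi> ?z' \<cdot> FArr M (q, f ?z'))"
      using arrs q by (simp add: arrow_rules extend_map_def comp_assoc module_comp)
    also have "\<dots> = FArr N (?w', T (\<epsilon> + \<delta>) q') \<cdot> ((\<phi> ?z' \<cdot> FArr M (f ?z, f ?z')) \<cdot> FArr M (q, f ?z))"
      using arrs f_mono[OF z] by (simp add: arrow_rules comp_assoc module_comp)
    also have "\<dots> = FArr N (?w, T (\<epsilon> + \<delta>) q') \<cdot> (\<phi> ?z \<cdot> FArr M (q, f ?z))"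
      using arrs w by (simp add: arrow_rules pulled_back_map_natural[OF \<phi> z] comp_assoc module_comp_left)
    also have "\<dots> = FArr N (T (\<epsilon> + \<delta>) q, T (\<epsilon> + \<delta>) q') \<cdot> extend_map \<epsilon> M N \<phi> q"
      using arrs t by (simp add: arrow_rules extend_map_def module_comp_left)
    finally show ?thesis .
  qed
qed

text \<open>
  As in \<open>restrict_round_trip\<close>, naturality of \<open>\<psi>\<close> makes \<open>\<psi>\<close> directly follow \<open>\<phi>\<close>. With \<open>z = g (T \<delta> q)\<close>,
  the interleaving equation at \<open>z\<close> applies because the image of \<open>transport T (2 * \<epsilon>) z\<close> lies below
  \<open>T (2 * \<epsilon> + \<delta>) q\<close>, hence below \<open>T (2 * (\<epsilon> + \<delta>)) q\<close>.
\<close>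

lemma extend_round_trip:
  assumes MN: "is_module C M" "is_module C N" and \<epsilon>: "0 \<le> \<epsilon>"
    and \<phi>: "module_map C (pullback f M) (shiftQ (transport T) \<epsilon> (pullback f N)) \<phi>"
    and \<psi>: "module_map C (pullback f N) (shiftQ (transport T) \<epsilon> (pullback f M)) \<psi>"
    and trip: "round_trip (transport T) \<epsilon> (pullback f M) \<phi> \<psi>"
  shows "round_trip T (\<epsilon> + \<delta>) M (extend_map \<epsilon> M N \<phi>) (extend_map \<epsilon> N M \<psi>)"
  unfolding round_trip_def
proof
  fix q
  let ?\<epsilon>' = "\<epsilon> + \<delta>" and ?S = "transport T"
  let ?y = "T ?\<epsilon>' q" and ?z = "g (T \<delta> q)"
  let ?v = "g (T \<delta> ?y)" and ?w = "?S \<epsilon> ?z" and ?t = "T (2 * ?\<epsilon>') q" and ?u = "?S (2 * \<epsilon>) ?z"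
  have S: "superlinear_family ?S" using superlinear_family_transport[OF T] .
  have \<epsilon>': "0 \<le> ?\<epsilon>'" using \<epsilon> \<delta> by simp
  have z: "q \<le> f ?z" using approx .
  have wy: "f ?w \<le> ?y" using transport_approx_le'[OF \<epsilon>] .
  have yv: "?y \<le> f ?v" using approx .
  have wv: "?w \<le> ?v"
    using order_trans[OF transport_approx_le[OF \<epsilon>, of q] superlinear_familyD(2)[OF T \<delta>]]
    by (simp add: transport_def g_mono)
  have SvT: "f (?S \<epsilon> ?v) \<le> T ?\<epsilon>' ?y" using transport_approx_le'[OF \<epsilon>] .
  have Tt: "T ?\<epsilon>' ?y \<le> ?t" using superlinear_family_twice[OF T \<epsilon>'] .
  have SwSv: "f (?S \<epsilon> ?w) \<le> f (?S \<epsilon> ?v)" using f_mono[OF superlinear_familyD(1)[OF S \<epsilon> wv]] .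
  have Swu: "f (?S \<epsilon> ?w) \<le> f ?u" using f_mono[OF superlinear_family_twice[OF S \<epsilon>]] .
  have zu: "f ?z \<le> f ?u" using f_mono superlinear_familyD(2)[OF S] \<epsilon> by simp
  have ut: "f ?u \<le> ?t"
    using order_trans[OF transport_approx_le'[of "2 * \<epsilon>" q]
        superlinear_family_index_mono[OF T, of "2 * \<epsilon> + \<delta>" "2 * ?\<epsilon>'"]] \<epsilon> \<delta> by simp
  note le = z wy yv SvT Tt SwSv Swu zu ut f_mono[OF wv] order_trans[OF SvT Tt] order_trans[OF Swu ut]
    order_trans[OF zu ut]
  note arrs = MN le pulled_back_map_arr[OF \<phi>] pulled_back_map_arr[OF \<psi>]
  have "FArr M (T ?\<epsilon>' ?y, ?t) \<cdot> (extend_map \<epsilon> N M \<psi> ?y \<cdot> extend_map \<epsilon> M N \<phi> q)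
      = FArr M (T ?\<epsilon>' ?y, ?t) \<cdot> ((FArr M (f (?S \<epsilon> ?v), T ?\<epsilon>' ?y) \<cdot> (\<psi> ?v \<cdot> FArr N (?y, f ?v))) \<cdot>
          (FArr N (f ?w, ?y) \<cdot> (\<phi> ?z \<cdot> FArr M (q, f ?z))))"
    by (simp add: extend_map_def)
  also have "\<dots> = FArr M (f (?S \<epsilon> ?v), ?t) \<cdot> ((\<psi> ?v \<cdot> FArr N (f ?w, f ?v)) \<cdot> (\<phi> ?z \<cdot> FArr M (q, f ?z)))"
    using arrs by (simp add: arrow_rules comp_assoc module_comp_left)
  also have "\<dots> = FArr M (f (?S \<epsilon> ?w), ?t) \<cdot> ((\<psi> ?w \<cdot> \<phi> ?z) \<cdot> FArr M (q, f ?z))"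
    using arrs by (simp add: arrow_rules pulled_back_map_natural[OF \<psi> wv] comp_assoc module_comp_left)
  also have "\<dots> = FArr M (f ?u, ?t) \<cdot> ((FArr M (f (?S \<epsilon> ?w), f ?u) \<cdot> (\<psi> ?w \<cdot> \<phi> ?z)) \<cdot> FArr M (q, f ?z))"
    using arrs by (simp add: arrow_rules comp_assoc module_comp_left)
  also have "FArr M (f (?S \<epsilon> ?w), f ?u) \<cdot> (\<psi> ?w \<cdot> \<phi> ?z) = FArr M (f ?z, f ?u)"
    using trip by (simp add: round_trip_def pullback_def)
  also have "FArr M (f ?u, ?t) \<cdot> (FArr M (f ?z, f ?u) \<cdot> FArr M (q, f ?z)) = FArr M (q, ?t)"
    using arrs by (simp add: arrow_rules module_comp module_comp_left order_trans[OF z])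
  finally show "FArr M (T ?\<epsilon>' ?y, ?t) \<cdot> (extend_map \<epsilon> N M \<psi> ?y \<cdot> extend_map \<epsilon> M N \<phi> q)
      = FArr M (q, ?t)" .
qed

theorem relative_interleaving_of_interleaving:
  assumes MN: "is_module C M" "is_module C N" and \<epsilon>: "0 \<le> \<epsilon>"
    and "weak_interleavingQ C T \<epsilon> M N \<phi> \<psi>"
  shows "\<exists>\<phi> \<psi>. weak_interleavingP C f T (\<epsilon> + \<delta>) (pullback f M) (pullback f N) \<phi> \<psi>"
proof -
  have \<epsilon>': "0 \<le> \<epsilon> + \<delta>" using \<epsilon> \<delta> by simp
  have fMN: "is_module C (pullback f M)" "is_module C (pullback f N)"
    using MN by (auto intro!: pullback_module monoI f_mono)
  from assms(4) have "module_map C M (shiftQ T \<epsilon> N) \<phi>" "module_map C N (shiftQ T \<epsilon> M) \<psi>"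
    "round_trip T \<epsilon> M \<phi> \<psi>" "round_trip T \<epsilon> N \<psi> \<phi>"
    using weak_interleavingQ_iff_round_trip[OF T \<epsilon> MN] by auto
  then have "weak_interleavingQ C (transport T) (\<epsilon> + \<delta>) (pullback f M) (pullback f N)
      (restrict_map \<epsilon> N \<phi>) (restrict_map \<epsilon> M \<psi>)"
    using weak_interleavingQ_iff_round_trip[OF superlinear_family_transport[OF T] \<epsilon>' fMN]
      restrict_map_natural restrict_round_trip MN \<epsilon> by blast
  then show ?thesis
    using weak_interleavingP_iff_transport[OF T \<epsilon>' fMN] by blast
qed

theorem interleaving_of_relative_interleaving:
  assumes MN: "is_module C M" "is_module C N" and \<epsilon>: "0 \<le> \<epsilon>"
    and "weak_interleavingP C f T \<epsilon> (pullback f M) (pullback f N) \<phi> \<psi>"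
  shows "\<exists>\<phi> \<psi>. weak_interleavingQ C T (\<epsilon> + \<delta>) M N \<phi> \<psi>"
proof -
  have \<epsilon>': "0 \<le> \<epsilon> + \<delta>" using \<epsilon> \<delta> by simp
  have fMN: "is_module C (pullback f M)" "is_module C (pullback f N)"
    using MN by (auto intro!: pullback_module monoI f_mono)
  obtain \<phi>' \<psi>' where "weak_interleavingQ C (transport T) \<epsilon> (pullback f M) (pullback f N) \<phi>' \<psi>'"
    using weak_interleavingP_iff_transport[OF T \<epsilon> fMN] assms(4) by blast
  then have "module_map C (pullback f M) (shiftQ (transport T) \<epsilon> (pullback f N)) \<phi>'"
    "module_map C (pullback f N) (shiftQ (transport T) \<epsilon> (pullback f M)) \<psi>'"
    "round_trip (transport T) \<epsilon> (pullback f M) \<phi>' \<psi>'"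
    "round_trip (transport T) \<epsilon> (pullback f N) \<psi>' \<phi>'"
    using weak_interleavingQ_iff_round_trip[OF superlinear_family_transport[OF T] \<epsilon> fMN] by auto
  then have "weak_interleavingQ C T (\<epsilon> + \<delta>) M N (extend_map \<epsilon> M N \<phi>') (extend_map \<epsilon> N M \<psi>')"
    using weak_interleavingQ_iff_round_trip[OF T \<epsilon>' MN]
      extend_map_natural extend_round_trip MN \<epsilon> by blast
  then show ?thesis by blast
qed

end

end

section \<open>The distortion of the pullback\<close>

lemma Inf_index_le_add:
  assumes "0 \<le> d" "\<And>\<epsilon>. 0 \<le> \<epsilon> \<Longrightarrow> P \<epsilon> \<Longrightarrow> P' (\<epsilon> + d)"
  shows "Inf {ennreal \<epsilon> |\<epsilon>. \<epsilon> \<ge> 0 \<and> P' \<epsilon>} \<le> Inf {ennreal \<epsilon> |\<epsilon>. \<epsilon> \<ge> 0 \<and> P \<epsilon>} + ennreal d"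
proof -
  have "Inf {ennreal \<epsilon> |\<epsilon>. \<epsilon> \<ge> 0 \<and> P' \<epsilon>} - ennreal d \<le> Inf {ennreal \<epsilon> |\<epsilon>. \<epsilon> \<ge> 0 \<and> P \<epsilon>}"
  proof (rule Inf_greatest)
    fix x assume "x \<in> {ennreal \<epsilon> |\<epsilon>. \<epsilon> \<ge> 0 \<and> P \<epsilon>}"
    then obtain \<epsilon> where \<epsilon>: "x = ennreal \<epsilon>" "0 \<le> \<epsilon>" "P \<epsilon>" by blast
    then have "Inf {ennreal \<epsilon> |\<epsilon>. \<epsilon> \<ge> 0 \<and> P' \<epsilon>} \<le> ennreal (\<epsilon> + d)"
      using assms(2)[of \<epsilon>] assms(1) by (intro Inf_lower CollectI exI[of _ "\<epsilon> + d"]) simp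
    then show "Inf {ennreal \<epsilon> |\<epsilon>. \<epsilon> \<ge> 0 \<and> P' \<epsilon>} - ennreal d \<le> x"
      using \<epsilon> assms(1) by (simp add: ennreal_minus_le_iff ennreal_plus add.commute)
  qed
  then show ?thesis by (simp add: ennreal_minus_le_iff add.commute)
qed

theorem theorem5p15:
  fixes C :: "('o, 'a) cat"
    and T :: "real \<Rightarrow> 'q::order \<Rightarrow> 'q"
    and f :: "'l::complete_lattice \<Rightarrow> 'q"
    and \<delta> :: real
    and M N :: "('q, 'o, 'a) pmod"
  assumes "category C"
    and "cocomplete TYPE('l) TYPE('l \<times> 'l) C"
    and "superlinear_family T"
    and "\<delta> \<ge> 0"
    and "delta_approximation T \<delta> f"
    and "respects_joins f"
    and "is_module C M"
    and "is_module C N"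
  shows "distQ C T M N \<le> distP C f T (pullback f M) (pullback f N) + ennreal (2 * \<delta>) \<and>
         distP C f T (pullback f M) (pullback f N) \<le> distQ C T M N + ennreal (2 * \<delta>)"
proof -
  define g where "g q = Sup {p. f p \<le> q}" for q
  have f_mono: "f p \<le> f p'" if "p \<le> p'" for p p'
    using assms(6) that by (simp add: respects_joins_def monoD)
  have "f (g q) \<le> q" for q
    using assms(6) by (simp add: respects_joins_def g_def)
  then have adjoint: "f p \<le> q \<longleftrightarrow> p \<le> g q" for p q
    using f_mono order_trans unfolding g_def by (metis Sup_upper mem_Collect_eq)
  interpret adjoint_pushforward C f g
    using assms(1) adjoint by unfold_locales
  have approx: "q \<le> f (g (T \<delta> q))" for q
  proof -
    obtain p where "q \<le> f p" "f p \<le> T \<delta> q"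
      using assms(5) unfolding delta_approximation_def by blast
    then show ?thesis using adjoint f_mono order_trans by blast
  qed
  have "distQ C T M N \<le> distP C f T (pullback f M) (pullback f N) + ennreal \<delta>"
    unfolding distQ_def distP_def
    using interleaving_of_relative_interleaving[OF assms(3,4) approx assms(7,8)] assms(4)
    by (intro Inf_index_le_add) blast+
  moreover have "distP C f T (pullback f M) (pullback f N) \<le> distQ C T M N + ennreal \<delta>"
    unfolding distQ_def distP_def
    using relative_interleaving_of_interleaving[OF assms(3,4) approx assms(7,8)] assms(4)
    by (intro Inf_index_le_add) blast+
  moreover have "ennreal \<delta> \<le> ennreal (2 * \<delta>)"
    using assms(4) by (intro ennreal_leI) simp
  ultimately show ?thesis
    by (meson add_left_mono order_trans)
qed

end
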